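(* Let $d\ge 1$ be an integer and let $(U_i)_{i\ge 1}$ be a sequence of open subsets of the torus $\mathbb{T}^d$. Let $v=(v_i)_{i\ge 1}$ be a sequence of independent random vectors, each uniformly distributed on $\mathbb{T}^d$. Put $V_i(v_i)=U_i+v_i$ and \[ E(v)=\limsup_{i\to\infty}V_i(v_i)=\bigcap_{n\ge 1}\bigcup_{i\ge n}V_i(v_i). \] Define \[ s=\inf\Bigl\{\,t\in(0,d] : \sum_{i=1}^\infty \lambda(U_i)^{t/d}<\infty \ \text{ or } \ t=d\,\Bigr\}. \] Then almost surely $E(v)\in\mathscr{G}^s(\mathbb{T}^d)$.
   Context: $\mathbb{T}^d=\mathbb{R}^d/\mathbb{Z}^d$ is the $d$-dimensional torus, with addition inherited from $\mathbb{R}^d$. $\lambda$ denotes the $d$-dimensional Lebesgue measure on $\mathbb{T}^d$ (so $\lambda(\mathbb{T}^d)=1$); "uniformly distributed" means with law $\lambda$. Large intersection classes (Falconer). Identify $\mathbb{T}^d$ with $[0,1)^d$. A dyadic cube is a set of the form $\prod_{j=1}^d[k_j2^{-n},(k_j+1)2^{-n})$ with integers $n\ge 0$ and $0\le k_j<2^n$; $|Q|$ denotes the diameter of the cube $Q$. For $t>0$ and $A\subset\mathbb{T}^d$ let \[ \mathcal{M}^t_\infty(A)=\inf\Bigl\{\sum_j|Q_j|^t : (Q_j)\text{ a countable family of dyadic cubes with } A\subset\bigcup_jQ_j\Bigr\}. \] The class $\mathscr{G}^s(\mathbb{T}^d)$ consists of all $G_\delta$ sets $A\subset\mathbb{T}^d$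 such that $\mathcal{M}^t_\infty(A\cap Q)=\mathcal{M}^t_\infty(Q)$ for every $0<t<s$ and every dyadic cube $Q$ (for $s=0$ this condition is empty). For $0<s\le d$, countable intersections of sets in $\mathscr{G}^s(\mathbb{T}^d)$ belong to $\mathscr{G}^s(\mathbb{T}^d)$, and every set in $\mathscr{G}^s(\mathbb{T}^d)$ has Hausdorff dimension at least $s$. *)

theory Defs
  imports "HOL-Probability.Probability"
begin

text \<open>The torus is identified with its fundamental domain \<open>[0,1)\<^sup>d\<close> in \<open>real ^ 'n\<close>, where
  \<open>d = CARD('n) \<ge> 1\<close>. Its topology is not the subspace topology of the fundamental domain but
  the quotient topology of \<open>\<real>\<^sup>d / \<int>\<^sup>d\<close>.\<close>

definition torus :: "(real ^ 'n) set" where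
  "torus = {x. \<forall>j. 0 \<le> x $ j \<and> x $ j < 1}"

definition torus_proj :: "real ^ 'n \<Rightarrow> real ^ 'n" where
  "torus_proj x = (\<chi> j. frac (x $ j))"

definition torus_translate :: "(real ^ 'n) set \<Rightarrow> real ^ 'n \<Rightarrow> (real ^ 'n) set" where
  "torus_translate A v = (\<lambda>u. torus_proj (u + v)) ` A"

definition torus_topology :: "(real ^ 'n) topology" where
  "torus_topology = topology (\<lambda>U. U \<subseteq> torus \<and> open (torus_proj -` U))"

definition torus_measure :: "(real ^ 'n) measure" where
  "torus_measure = restrict_space lborel torus"

definition dyadic_cube :: "nat \<Rightarrow> ('n \<Rightarrow> nat) \<Rightarrow> (real ^ 'n) set" where
  "dyadic_cube n k = {x. \<forall>j. real (k j) / 2 ^ n \<le> x $ j \<and> x $ j < (real (k j) + 1) / 2 ^ n}"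

definition dyadic_cubes :: "(real ^ 'n) set set" where
  "dyadic_cubes = {dyadic_cube n k | n k. \<forall>j. k j < 2 ^ n}"

text \<open>Countable families of cubes, finite ones included, are indexed by sets of natural numbers.\<close>

definition net_content :: "real \<Rightarrow> (real ^ 'n) set \<Rightarrow> ennreal" where
  "net_content t A =
    Inf {(\<Sum>\<^sub>\<infinity>j\<in>J. ennreal (diameter (Q j) powr t)) | (J :: nat set) Q.
         (\<forall>j\<in>J. Q j \<in> dyadic_cubes) \<and> A \<subseteq> (\<Union>j\<in>J. Q j)}"

definition large_intersection_class :: "real \<Rightarrow> (real ^ 'n) set set" where
  "large_intersection_class s =
    {A. gdelta_in torus_topology A \<and>
        (\<forall>t Q. 0 < t \<and> t < s \<and> Q \<in> dyadic_cubes \<longrightarrow>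
           net_content t (A \<inter> Q) = net_content t Q)}"

lemma torus_proj_in_torus: "torus_proj x \<in> torus"
  by (simp add: torus_def torus_proj_def frac_lt_1)

lemma torus_proj_eq_self_iff: "torus_proj x = x \<longleftrightarrow> x \<in> torus"
  by (simp add: torus_def torus_proj_def vec_eq_iff frac_eq all_conj_distrib)

lemma openin_torus_topology:
  fixes U :: "(real ^ 'n) set"
  shows "openin torus_topology U \<longleftrightarrow> U \<subseteq> torus \<and> open (torus_proj -` U)"
proof -
  have "istopology (\<lambda>U :: (real ^ 'n) set. U \<subseteq> torus \<and> open (torus_proj -` U))"
    unfolding istopology_def by (auto simp: vimage_Union)
  then show ?thesis
    by (simp add: torus_topology_def topology_inverse')
qed

lemma topspace_torus_topology: "topspace torus_topology = torus"
proof
  show "topspace torus_topology \<subseteq> torus"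
    by (auto simp: topspace_def openin_torus_topology)
  have "torus_proj -` torus = UNIV"
    by (auto simp: torus_proj_in_torus)
  then show "torus \<subseteq> topspace torus_topology"
    by (metis openin_subset openin_torus_topology open_UNIV order_refl)
qed

lemma quotient_map_torus_proj: "quotient_map euclidean torus_topology torus_proj"
proof -
  have "torus_proj ` UNIV = torus"
    by (metis (no_types, lifting) image_subset_iff rangeI subsetI subset_antisym
        torus_proj_eq_self_iff torus_proj_in_torus)
  then show ?thesis
    by (auto simp: quotient_map_def topspace_torus_topology openin_torus_topology vimage_def)
qed

lemma emeasure_torus_measure_torus: "emeasure torus_measure (torus :: (real ^ 'n) set) = 1"
proof -
  have box: "box 0 1 \<subseteq> (torus :: (real ^ 'n) set)" "(torus :: (real ^ 'n) set) \<subseteq> cbox 0 1"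
    by (auto simp: torus_def mem_box_cart less_imp_le)
  have meas: "(torus :: (real ^ 'n) set) \<in> sets borel"
    unfolding torus_def by measurable
  have 1: "i \<in> Basis \<Longrightarrow> (1 :: real ^ 'n) \<bullet> i = 1" for i
    by (auto simp: Basis_vec_def inner_axis)
  have "emeasure lborel (box 0 (1 :: real ^ 'n)) = 1" "emeasure lborel (cbox 0 (1 :: real ^ 'n)) = 1"
    by (simp_all add: emeasure_lborel_box_eq emeasure_lborel_cbox_eq 1)
  then have "emeasure lborel (torus :: (real ^ 'n) set) = 1"
    by (metis antisym box emeasure_mono meas sets_lborel borel_closed closed_cbox)
  then show ?thesis
    using meas by (simp add: torus_measure_def emeasure_restrict_space)
qed

lemma openin_torus_topology_imp_sets:
  fixes U :: "(real ^ 'n) set"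
  assumes "openin torus_topology U"
  shows "U \<in> sets torus_measure"
proof -
  have "U = torus \<inter> torus_proj -` U"
    using assms by (auto simp: openin_torus_topology torus_proj_eq_self_iff[THEN iffD2] subset_iff)
  moreover have "torus_proj -` U \<in> sets lborel"
    using assms by (simp add: openin_torus_topology)
  ultimately show ?thesis
    unfolding torus_measure_def sets_restrict_space by blast
qed

end

theory Submission
  imports Defs
begin

text \<open>
  Write \<open>W\<^sub>n\<close> for the union of the translates with index at least \<open>n\<close>, so that the limsup set is
  the intersection of the open sets \<open>W\<^sub>n\<close>; let \<open>d\<close> be the dimension, \<open>\<lambda>\<close> Lebesgue measure and
  \<open>u\<^sub>i\<close> the measure of the \<open>i\<close>-th open set. Everything is measured on dyadic cubes: for a measure
  \<open>\<nu>\<close>, the discrepancy \<open>D\<^sub>t(\<nu>)\<close> is the sum of \<open>2\<^bsup>lt\<^esup> (\<nu>(C) - \<lambda>(C))\<^sup>2\<close> over all levels \<open>l\<close> and all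
  cubes \<open>C\<close> of level \<open>l\<close>. A set is almost uniform of exponent \<open>t\<close> if it carries absolutely
  continuous measures of arbitrarily small discrepancy.

  Chance enters only in showing that each \<open>W\<^sub>n\<close> is almost surely almost uniform of every exponent
  \<open>t < s\<close> (\<open>AE_almost_uniform_union\<close>). Choose \<open>\<tau>\<close> with \<open>t < \<tau> < s\<close> and put \<open>\<theta> = \<tau>/d\<close>. The measure
  is the average of Lebesgue measure on finitely many translates, with weights
  proportional to \<open>u\<^sub>i\<^bsup>\<theta>-1\<^esup>\<close>. A uniform translation makes the mean mass of every cube equal to its
  volume, and the overlap of a translate with \<open>C\<close> is at most
  \<open>min u\<^sub>i \<lambda>(C) \<le> u\<^sub>i\<^bsup>1-\<theta>\<^esup> \<lambda>(C)\<^bsup>\<theta>\<^esup>\<close>; so by independence the variance of the mass of \<open>C\<close> is at most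
  \<open>\<lambda>(C)\<^bsup>1+\<theta>\<^esup> / S\<close>, where \<open>S\<close> is the sum of \<open>u\<^sub>i\<^bsup>\<theta>\<^esup>\<close> over the translates used
  (\<open>variance_weighted_overlaps\<close>). Because \<open>t < \<tau>\<close>, these bounds can be summed over all cubes, and the
  expected discrepancy is at most a constant divided by \<open>S\<close>. Because \<open>\<tau> < s\<close>, the sums \<open>S\<close> are unbounded.

  The rest is deterministic. If \<open>W\<close> is almost uniform, then any family of subcubes of a cube \<open>P\<close>
  that covers \<open>W\<close> inside \<open>P\<close> has total weight at least that of \<open>P\<close>: nearly all of the mass
  \<open>\<lambda>(P)\<close> must be accounted for, and a subcube of \<open>P\<close> has little volume compared with its weight
  (\<open>weight_le_cost_of_cover\<close>). This passes to countable intersections in the manner of Baire's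
  theorem. Given a family of cubes cheaper than \<open>Q\<close>, one descends through cubes
  \<open>Q = P\<^sub>0 \<supseteq> P\<^sub>1 \<supseteq> \<dots>\<close> with the closure of \<open>P\<^bsub>n+1\<^esub>\<close> inside \<open>W\<^sub>n\<close> and the interior of \<open>P\<^sub>n\<close>, in such a way
  that inside every \<open>P\<^sub>n\<close> the family remains cheaper than \<open>P\<^sub>n\<close> and none of its members contains
  \<open>P\<^sub>n\<close> (\<open>descend_avoiding_cover\<close>). The common point of the \<open>P\<^sub>n\<close> lies in all \<open>W\<^sub>n\<close> and in no member of
  the family, so no cover of the limsup set inside \<open>Q\<close> is cheaper than \<open>Q\<close> itself.
\<close>

section \<open>Dyadic cubes and their addresses\<close>

abbreviation cube :: "nat \<times> ('n \<Rightarrow> nat) \<Rightarrow> (real ^ 'n) set" where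
  "cube c \<equiv> dyadic_cube (fst c) (snd c)"

definition cube_indices :: "(nat \<times> ('n \<Rightarrow> nat)) set" where
  "cube_indices = {c. \<forall>j. snd c j < 2 ^ fst c}"

text \<open>
  Inside the torus, \<open>address n x\<close> indexes the unique cube of level \<open>n\<close> containing \<open>x\<close>. Cubes are
  handled through their indices (level and corner), so that families of cubes become subsets of a
  countable set on which sums over cubes are integrals.
\<close>

definition address :: "nat \<Rightarrow> real ^ 'n \<Rightarrow> nat \<times> ('n \<Rightarrow> nat)" where
  "address n x = (n, \<lambda>j. nat \<lfloor>2 ^ n * x $ j\<rfloor>)"

lemma dyadic_cubes_eq: "(dyadic_cubes :: (real ^ 'n) set set) = cube ` cube_indices"
proof (intro equalityI subsetI)
  fix Q :: "(real ^ 'n) set" assume "Q \<in> dyadic_cubes"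
  then obtain n k where "Q = dyadic_cube n k" "\<forall>j. k j < 2 ^ n"
    by (auto simp: dyadic_cubes_def)
  then have "Q = cube (n, k)" "(n, k) \<in> cube_indices"
    by (simp_all add: cube_indices_def)
  then show "Q \<in> cube ` cube_indices"
    by blast
qed (auto simp: dyadic_cubes_def cube_indices_def)

lemma mem_dyadic_cube: "x \<in> dyadic_cube n k \<longleftrightarrow> (\<forall>j. \<lfloor>2 ^ n * x $ j\<rfloor> = int (k j))"
  unfolding dyadic_cube_def floor_eq_iff mem_Collect_eq
  by (simp add: pos_divide_le_eq pos_less_divide_eq mult.commute)

lemma address_eq_iff: "x \<in> cube c \<Longrightarrow> address (fst c) x = c"
  by (cases c) (auto simp: mem_dyadic_cube address_def)

lemma mem_cube_address:
  assumes "x \<in> torus"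
  shows "x \<in> cube (address n x)"
  using assms by (auto simp: mem_dyadic_cube address_def torus_def)

lemma fst_address [simp]: "fst (address n x) = n"
  by (simp add: address_def)

lemma address_in_cube_indices:
  assumes "x \<in> torus"
  shows "address n x \<in> cube_indices"
proof -
  have "nat \<lfloor>2 ^ n * x $ j\<rfloor> < 2 ^ n" for j
  proof -
    have "2 ^ n * x $ j < 2 ^ n"
      using assms by (simp add: torus_def)
    then have "\<lfloor>2 ^ n * x $ j\<rfloor> < int (2 ^ n)"
      by (simp add: floor_less_iff)
    then show ?thesis
      by (simp add: nat_less_iff)
  qed
  then show ?thesis
    by (simp add: cube_indices_def address_def)
qed

lemma cube_subset_torus:
  assumes "c \<in> cube_indices"
  shows "cube c \<subseteq> torus"
proof
  fix x assume x: "x \<in> cube c"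
  have "0 \<le> x $ j \<and> x $ j < 1" for j
  proof -
    have 1: "\<lfloor>2 ^ fst c * x $ j\<rfloor> = int (snd c j)"
      using x by (simp add: mem_dyadic_cube)
    then have "0 \<le> 2 ^ fst c * x $ j"
      by (metis of_nat_0_le_iff zero_le_floor)
    moreover have "\<lfloor>2 ^ fst c * x $ j\<rfloor> < 2 ^ fst c"
      using assms 1 by (simp add: cube_indices_def)
    then have "2 ^ fst c * x $ j < 2 ^ fst c"
      by (simp add: floor_less_iff)
    moreover have "(0 :: real) < 2 ^ fst c"
      by simp
    ultimately show ?thesis
      by (auto simp: zero_le_mult_iff)
  qed
  then show "x \<in> torus"
    by (simp add: torus_def)
qed

lemma floor_coarser:
  fixes x :: real
  assumes "l \<le> l'"
  shows "\<lfloor>2 ^ l * x\<rfloor> = \<lfloor>2 ^ l' * x\<rfloor> div 2 ^ (l' - l)"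
proof -
  have "(2::real) ^ l' = 2 ^ l * 2 ^ (l' - l)"
    using assms by (simp flip: power_add)
  then have "2 ^ l * x = 2 ^ l' * x / real_of_int (2 ^ (l' - l))"
    by simp
  then show ?thesis
    by (simp only: floor_divide_real_eq_div[OF zero_le_power] zero_le_numeral)
qed

text \<open>
  Two dyadic cubes that meet are comparable, since the corner of a cube is determined by the corner
  of any finer cube it meets.
\<close>

lemma cube_nested:
  assumes "x \<in> cube b" "x \<in> cube c" "fst b \<le> fst c"
  shows "cube c \<subseteq> cube b"
proof
  fix y assume y: "y \<in> cube c"
  have "\<lfloor>2 ^ fst b * y $ j\<rfloor> = \<lfloor>2 ^ fst b * x $ j\<rfloor>" for j
    using y assms(2) by (simp add: mem_dyadic_cube floor_coarser[OF assms(3)])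
  then show "y \<in> cube b"
    using assms(1) by (simp add: mem_dyadic_cube)
qed

lemma cube_between_boxes:
  fixes c :: "nat \<times> ('n::finite \<Rightarrow> nat)"
  defines "a \<equiv> \<chi> j. real (snd c j) / 2 ^ fst c" and "b \<equiv> \<chi> j. (real (snd c j) + 1) / 2 ^ fst c"
  shows "box a b \<subseteq> cube c" "cube c \<subseteq> cbox a b"
  by (auto simp: a_def b_def dyadic_cube_def mem_box_cart less_imp_le)

lemma sets_cube [measurable]: "cube c \<in> sets borel"
  unfolding dyadic_cube_def by measurable

lemma sets_torus [measurable]: "torus \<in> sets borel"
  unfolding torus_def by measurable

lemma emeasure_cube_boxes:
  fixes c :: "nat \<times> ('n::finite \<Rightarrow> nat)"
  defines "a \<equiv> \<chi> j. real (snd c j) / 2 ^ fst c" and "b \<equiv> \<chi> j. (real (snd c j) + 1) / 2 ^ fst c"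
  shows "emeasure lborel (box a b) = ennreal ((1 / 2 ^ fst c) ^ CARD('n))"
        "emeasure lborel (cbox a b) = ennreal ((1 / 2 ^ fst c) ^ CARD('n))"
proof -
  have "(b - a) \<bullet> i = 1 / 2 ^ fst c \<and> a \<bullet> i \<le> b \<bullet> i" if "i \<in> Basis" for i
    using that by (auto simp: Basis_vec_def inner_axis a_def b_def field_simps)
  then show "emeasure lborel (box a b) = ennreal ((1 / 2 ^ fst c) ^ CARD('n))"
        "emeasure lborel (cbox a b) = ennreal ((1 / 2 ^ fst c) ^ CARD('n))"
    by (simp_all add: emeasure_lborel_box_eq emeasure_lborel_cbox_eq)
qed

lemma emeasure_cube:
  "emeasure lborel (cube c :: (real ^ 'n) set) = ennreal ((1 / 2 ^ fst c) ^ CARD('n))"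
proof (rule antisym)
  show "emeasure lborel (cube c :: (real ^ 'n) set) \<le> ennreal ((1 / 2 ^ fst c) ^ CARD('n))"
    using emeasure_mono[OF cube_between_boxes(2)[of c], of lborel] by (simp add: emeasure_cube_boxes)
  show "ennreal ((1 / 2 ^ fst c) ^ CARD('n)) \<le> emeasure lborel (cube c :: (real ^ 'n) set)"
    using emeasure_mono[OF cube_between_boxes(1)[of c], of lborel] by (simp add: emeasure_cube_boxes)
qed

lemma measure_cube:
  "measure lborel (cube c :: (real ^ 'n) set) = (1 / 2 ^ fst c) ^ CARD('n)"
  by (simp add: measure_def emeasure_cube)

lemma cube_boundary_null:
  "cube c - interior (cube c) \<in> null_sets lborel"
proof -
  define a b where "a = (\<chi> j. real (snd c j) / 2 ^ fst c)"
    and "b = (\<chi> j. (real (snd c j) + 1) / 2 ^ fst c)"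
  have sub: "cube c - interior (cube c) \<subseteq> cbox a b - box a b"
    using cube_between_boxes[of c] interior_maximal[of "box a b" "cube c"]
    unfolding a_def b_def by fastforce
  have "emeasure lborel (cbox a b - box a b) = emeasure lborel (cbox a b) - emeasure lborel (box a b)"
    by (intro emeasure_Diff) (auto simp: emeasure_cube_boxes a_def b_def intro: box_subset_cbox[THEN subsetD])
  then have "cbox a b - box a b \<in> null_sets lborel"
    by (simp add: null_sets_def emeasure_cube_boxes a_def b_def)
  then show ?thesis
    by (rule null_sets_subset[OF _ _ sub]) auto
qed

lemma level_le_of_cube_subset:
  assumes "cube c \<subseteq> cube b"
  shows "fst b \<le> fst c"
proof -
  have "emeasure lborel (cube c) \<le> emeasure lborel (cube b)"
    using assms by (intro emeasure_mono) auto
  then have "((1::real) / 2 ^ fst c) ^ CARD('a) \<le> (1 / 2 ^ fst b) ^ CARD('a)"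
    unfolding emeasure_cube by (simp add: ennreal_le_iff)
  then have "(1::real) / 2 ^ fst c \<le> 1 / 2 ^ fst b"
    by (subst (asm) power_mono_iff) auto
  then show ?thesis
    by (simp add: field_simps)
qed

lemma cube_nonempty: "\<exists>x. x \<in> cube c"
  by (rule exI[of _ "\<chi> j. real (snd c j) / 2 ^ fst c"]) (auto simp: dyadic_cube_def divide_strict_right_mono)

text \<open>
  Every cube is a similar copy of the unit cube, so its diameter is that of the unit cube divided by
  \<open>2\<^sup>n\<close>. The diameter of the unit cube enters the net contents only as a common factor.
\<close>

lemma dyadic_cube_eq_image_torus:
  "cube c = (\<lambda>x. (1 / 2 ^ fst c) *\<^sub>R (x + (\<chi> j. real (snd c j)))) ` (torus :: (real ^ 'n) set)"
  (is "_ = ?f ` _")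
proof (intro equalityI subsetI)
  fix x assume "x \<in> cube c"
  then have "2 ^ fst c *\<^sub>R x - (\<chi> j. real (snd c j)) \<in> torus"
    by (simp add: dyadic_cube_def torus_def field_simps)
  moreover have "x = ?f (2 ^ fst c *\<^sub>R x - (\<chi> j. real (snd c j)))"
    by simp
  ultimately show "x \<in> ?f ` torus"
    by blast
qed (auto simp: dyadic_cube_def torus_def field_simps)

lemma bounded_torus: "bounded (torus :: (real ^ 'n) set)"
proof (rule bounded_subset)
  show "bounded (cbox (0 :: real ^ 'n) 1)"
    by (rule bounded_cbox)
qed (auto simp: torus_def mem_box_cart less_imp_le)

lemma diameter_torus_pos: "0 < diameter (torus :: (real ^ 'n) set)"
proof -
  have "dist (0 :: real ^ 'n) (\<chi> j. 1 / 2) \<le> diameter (torus :: (real ^ 'n) set)"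
    by (intro diameter_bounded_bound bounded_torus) (auto simp: torus_def)
  moreover have "(0 :: real ^ 'n) \<noteq> (\<chi> j. 1 / 2)"
    by (simp add: vec_eq_iff)
  ultimately show ?thesis
    by (metis zero_less_dist_iff less_le_trans)
qed

lemma bounded_cube: "bounded (cube c)"
  using cube_between_boxes(2) bounded_cbox bounded_subset by blast

lemma diameter_cube:
  "diameter (cube c :: (real ^ 'n) set) = diameter (torus :: (real ^ 'n) set) / 2 ^ fst c"
proof (rule antisym)
  let ?f = "\<lambda>x. (1 / 2 ^ fst c) *\<^sub>R (x + (\<chi> j. real (snd c j))) :: real ^ 'n"
  have dist: "dist (?f x) (?f y) = dist x y / 2 ^ fst c" for x y
    by (simp add: dist_norm flip: scaleR_diff_right)
  show "diameter (cube c :: (real ^ 'n) set) \<le> diameter (torus :: (real ^ 'n) set) / 2 ^ fst c"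
  proof (rule diameter_le)
    show "(cube c :: (real ^ 'n) set) \<noteq> {} \<or> 0 \<le> diameter (torus :: (real ^ 'n) set) / 2 ^ fst c"
      using diameter_torus_pos[where 'n='n] by (simp add: less_imp_le)
    fix x' y' :: "real ^ 'n" assume "x' \<in> cube c" "y' \<in> cube c"
    then obtain x y where "x \<in> torus" "y \<in> torus" "x' = ?f x" "y' = ?f y"
      unfolding dyadic_cube_eq_image_torus by blast
    then show "norm (x' - y') \<le> diameter (torus :: (real ^ 'n) set) / 2 ^ fst c"
      using diameter_bounded_bound[OF bounded_torus, of x y] dist[of x y]
      by (simp add: dist_norm divide_right_mono)
  qed
  have "dist x y \<le> 2 ^ fst c * diameter (cube c :: (real ^ 'n) set)" if "x \<in> torus" "y \<in> torus" for x y :: "real ^ 'n"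
  proof -
    have "dist (?f x) (?f y) \<le> diameter (cube c :: (real ^ 'n) set)"
      by (rule diameter_bounded_bound[OF bounded_cube])
         (use that in \<open>auto simp: dyadic_cube_eq_image_torus\<close>)
    then show ?thesis
      unfolding dist by (simp add: field_simps)
  qed
  then have "diameter (torus :: (real ^ 'n) set) \<le> 2 ^ fst c * diameter (cube c :: (real ^ 'n) set)"
    by (intro diameter_le) (use diameter_ge_0[OF bounded_cube, of c] in \<open>auto simp: dist_norm\<close>)
  then show "diameter (torus :: (real ^ 'n) set) / 2 ^ fst c \<le> diameter (cube c :: (real ^ 'n) set)"
    by (simp add: field_simps)
qed

lemma cube_in_open:
  fixes S :: "(real ^ 'n) set"
  assumes "open S" "x \<in> S" "x \<in> torus"
  shows "\<exists>n>m. closure (cube (address n x)) \<subseteq> S"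
proof -
  obtain e where e: "e > 0" "cball x e \<subseteq> S"
    using assms open_contains_cball by blast
  have "(\<lambda>n. diameter (torus :: (real ^ 'n) set) / 2 ^ n) \<longlonglongrightarrow> 0"
    by (intro LIMSEQ_divide_realpow_zero) auto
  then have "\<forall>\<^sub>F n in sequentially. diameter (torus :: (real ^ 'n) set) / 2 ^ n < e"
    using e(1) by (rule order_tendstoD(2))
  then have "\<forall>\<^sub>F n in sequentially. diameter (torus :: (real ^ 'n) set) / 2 ^ n < e \<and> m < n"
    using eventually_gt_at_top by (rule eventually_conj)
  then obtain n where n: "diameter (torus :: (real ^ 'n) set) / 2 ^ n < e" "n > m"
    using eventually_happens'[OF sequentially_bot] by blast
  have "y \<in> cball x e" if "y \<in> cube (address n x)" for y
    using diameter_bounded_bound[OF bounded_cube mem_cube_address[OF assms(3)] that] n(1) diameter_cube[of "address n x"]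
    by simp
  then have "closure (cube (address n x)) \<subseteq> cball x e"
    by (intro closure_minimal) auto
  then show ?thesis
    using e n by blast
qed

section \<open>Covers of sets that carry almost uniform measures\<close>

lemma emeasure_UN_le_count_space:
  assumes "countable I" "\<And>i. i \<in> I \<Longrightarrow> X i \<in> sets M"
  shows "emeasure M (\<Union>i\<in>I. X i) \<le> (\<integral>\<^sup>+i. emeasure M (X i) \<partial>count_space I)"
proof -
  have "emeasure M (\<Union>i\<in>I. X i) = (\<integral>\<^sup>+x. indicator (\<Union>i\<in>I. X i) x \<partial>M)"
    using assms by (intro nn_integral_indicator[symmetric] sets.countable_UN') auto
  also have "\<dots> \<le> (\<integral>\<^sup>+x. \<integral>\<^sup>+i. indicator (X i) x \<partial>count_space I \<partial>M)"
  proof (rule nn_integral_mono)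
    fix x
    show "indicator (\<Union>i\<in>I. X i) x \<le> (\<integral>\<^sup>+i. indicator (X i) x \<partial>count_space I :: ennreal)"
    proof (cases "x \<in> (\<Union>i\<in>I. X i)")
      case True
      then obtain i where "i \<in> I" "x \<in> X i"
        by blast
      then show ?thesis
        using True nn_integral_ge_point[of i I "\<lambda>i. indicator (X i) x"] by simp
    qed simp
  qed
  also have "\<dots> = (\<integral>\<^sup>+i. \<integral>\<^sup>+x. indicator (X i) x \<partial>M \<partial>count_space I)"
    using assms by (intro nn_integral_count_space_nn_integral) auto
  also have "\<dots> = (\<integral>\<^sup>+i. emeasure M (X i) \<partial>count_space I)"
    using assms by (intro nn_integral_cong) auto
  finally show ?thesis .
qed

text \<open>
  The \<open>t\<close>-th power of the side length. It differs from the \<open>t\<close>-th power of the diameter by a factor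
  that does not depend on the cube.
\<close>

definition weight :: "real \<Rightarrow> nat \<times> ('n \<Rightarrow> nat) \<Rightarrow> real" where
  "weight t c = 2 powr (- (t * real (fst c)))"

text \<open>
  The total weight of a family of cubes, organised as a measure on the set of indices so that
  countable additivity regroups families of cubes.
\<close>

definition cost :: "real \<Rightarrow> (nat \<times> ('n \<Rightarrow> nat)) measure" where
  "cost t = point_measure UNIV (\<lambda>c. ennreal (weight t c))"

text \<open>
  A dyadic substitute for the \<open>t\<close>-energy of \<open>\<nu> - \<lambda>\<close>. Dividing by the weight means that a small
  discrepancy controls the masses of all cubes, at every scale, simultaneously.
\<close>

definition discrepancy :: "real \<Rightarrow> (real ^ 'n) measure \<Rightarrow> ennreal" where
  "discrepancy t \<nu> = (\<integral>\<^sup>+c. ennreal ((measure \<nu> (cube c) - measure lborel (cube c :: (real ^ 'n) set))\<^sup>2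
      / weight t c) \<partial>count_space cube_indices)"

text \<open>
  Absolute continuity is demanded so that boundaries of cubes carry no mass: the mass of a cube is then
  already carried by the open set \<open>W \<inter> interior (cube P)\<close>.
\<close>

definition almost_uniform :: "real \<Rightarrow> (real ^ 'n) set \<Rightarrow> bool" where
  "almost_uniform t W \<longleftrightarrow> (\<forall>e>0. \<exists>\<nu>. finite_measure \<nu> \<and> sets \<nu> = sets borel \<and>
     absolutely_continuous lborel \<nu> \<and> emeasure \<nu> (- W) = 0 \<and> discrepancy t \<nu> \<le> ennreal e)"

lemma weight_pos [simp]: "0 < weight t c"
  by (simp add: weight_def)

lemma weight_le_1: "0 \<le> t \<Longrightarrow> weight t c \<le> 1"
  using powr_mono[of "- (t * real (fst c))" 0 2] by (simp add: weight_def)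

lemma sets_cost [simp]: "sets (cost t) = UNIV"
  by (simp add: cost_def sets_point_measure)

lemma emeasure_cost: "emeasure (cost t) A = (\<integral>\<^sup>+c. ennreal (weight t c) \<partial>count_space A)"
  by (simp add: cost_def point_measure_def emeasure_density nn_integral_count_space_indicator)

lemma emeasure_cost_singleton: "emeasure (cost t) {c} = ennreal (weight t c)"
  by (simp add: emeasure_cost nn_integral_count_space_finite)

lemma measure_cube_powr:
  "measure lborel (cube c :: (real ^ 'n) set) = 2 powr - (real CARD('n) * real (fst c))"
  by (simp add: measure_cube powr_minus powr_realpow mult.commute divide_simps flip: powr_powr
      power_mult of_nat_mult)

text \<open>
  The ratio of volume to weight is \<open>2\<^bsup>l(t-d)\<^esup>\<close>, which decreases with the level \<open>l\<close> as \<open>t \<le> d\<close>.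
\<close>

lemma measure_cube_le_weight:
  fixes t :: real
  assumes "t \<le> real CARD('n)" "fst b \<le> fst c"
  shows "measure lborel (cube c :: (real ^ 'n) set)
    \<le> measure lborel (cube b :: (real ^ 'n) set) / weight t b * weight t c"
proof -
  have "(real CARD('n) - t) * real (fst b) \<le> (real CARD('n) - t) * real (fst c)"
    using assms by (intro mult_left_mono) auto
  then have "2 powr - (real CARD('n) * real (fst c)) \<le>
    2 powr (- (real CARD('n) * real (fst b)) + t * real (fst b) - t * real (fst c))"
    by (simp add: algebra_simps)
  also have "\<dots> = 2 powr - (real CARD('n) * real (fst b)) / weight t b * weight t c"
    by (simp add: weight_def powr_diff powr_add powr_minus divide_simps)
  finally show ?thesis
    by (simp add: measure_cube_powr)
qed

text \<open>
  The arithmetic-geometric mean inequality, used instead of the Cauchy-Schwarz inequality to sum the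
  deviations \<open>\<bar>\<delta>\<bar>\<close> over a family of cubes: the first term adds up to the cost of the family and the
  second one to the discrepancy.
\<close>

lemma le_mult_add_square_div:
  fixes \<delta> w \<eta> :: real
  assumes "0 < w" "0 < \<eta>"
  shows "\<bar>\<delta>\<bar> \<le> \<eta> * w + 1 / \<eta> * (\<delta>\<^sup>2 / w)"
proof -
  have "0 \<le> (\<bar>\<delta>\<bar> - \<eta> * w)\<^sup>2"
    by simp
  moreover have "0 \<le> \<bar>\<delta>\<bar> * (\<eta> * w)"
    using assms by simp
  ultimately have "\<bar>\<delta>\<bar> * (\<eta> * w) \<le> (\<eta> * w)\<^sup>2 + \<delta>\<^sup>2"
    by (simp add: power2_diff)
  then show ?thesis
    using assms by (simp add: field_simps power2_eq_square)
qed

text \<open>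
  With \<open>A\<close> the ratio of volume to weight for \<open>P\<close>, every cube of the cover has volume at most \<open>A\<close> times
  its weight. A measure on \<open>W\<close> of discrepancy at most \<open>\<eta>\<^sup>2\<close> therefore gives the covered part of \<open>P\<close>
  mass at most \<open>A\<close> times the cost of the cover, up to an error of order \<open>\<eta>\<close>, while it gives \<open>P\<close> its
  volume up to an error of order \<open>\<eta>\<close>. The constant is exactly \<open>1\<close> in the limit \<open>\<eta> \<rightarrow> 0\<close>.
\<close>

lemma weight_le_cost_of_cover:
  fixes W :: "(real ^ 'n) set"
  assumes W: "almost_uniform t W" "W \<in> sets borel"
    and t: "0 \<le> t" "t \<le> real CARD('n)"
    and P: "P \<in> cube_indices"
    and C: "C \<subseteq> cube_indices" "\<And>c. c \<in> C \<Longrightarrow> (cube c :: (real ^ 'n) set) \<subseteq> cube P"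
    and cover: "W \<inter> interior (cube P) \<subseteq> (\<Union>c\<in>C. cube c)"
  shows "ennreal (weight t P) \<le> emeasure (cost t) C"
proof (cases "emeasure (cost t) C = \<infinity>")
  case False
  define X where "X = measure (cost t) C"
  have X: "emeasure (cost t) C = ennreal X" "0 \<le> X"
    using False by (simp_all add: X_def emeasure_eq_ennreal_measure)
  define \<mu> where "\<mu> c = measure lborel (cube c :: (real ^ 'n) set)" for c :: "nat \<times> ('n \<Rightarrow> nat)"
  define A where "A = \<mu> P / weight t P"
  have \<mu>_pos: "0 < \<mu> c" for c
    by (simp add: \<mu>_def measure_cube)
  have A: "0 < A"
    by (simp add: A_def \<mu>_pos)
  have \<mu>_le: "\<mu> c \<le> A * weight t c" if "c \<in> C" for c
    unfolding A_def \<mu>_def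
    by (rule measure_cube_le_weight[OF t(2) level_le_of_cube_subset[OF C(2)[OF that]]])
  have bound: "\<mu> P \<le> A * X + \<eta> * (X + 3)" if \<eta>: "0 < \<eta>" for \<eta>
  proof -
    have "0 < \<eta>\<^sup>2"
      using \<eta> by simp
    then obtain \<nu> where \<nu>: "finite_measure \<nu>" "sets \<nu> = sets borel" "absolutely_continuous lborel \<nu>"
      "emeasure \<nu> (- W) = 0" "discrepancy t \<nu> \<le> ennreal (\<eta>\<^sup>2)"
      using W(1) unfolding almost_uniform_def by blast
    interpret finite_measure \<nu> by fact
    define \<delta> where "\<delta> c = measure \<nu> (cube c) - \<mu> c" for c
    define D where "D = discrepancy t \<nu>"
    have D: "D = (\<integral>\<^sup>+c. ennreal ((\<delta> c)\<^sup>2 / weight t c) \<partial>count_space cube_indices)"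
      by (simp add: D_def discrepancy_def \<delta>_def \<mu>_def)
    have "emeasure \<nu> (cube P) \<le> emeasure \<nu> ((W \<inter> interior (cube P)) \<union> (- W \<union> (cube P - interior (cube P))))"
      using W(2) by (intro emeasure_mono) (auto simp: \<nu>(2))
    also have "\<dots> \<le> emeasure \<nu> (W \<inter> interior (cube P)) + emeasure \<nu> (- W \<union> (cube P - interior (cube P)))"
      using W(2) by (intro emeasure_subadditive) (auto simp: \<nu>(2))
    also have "- W \<union> (cube P - interior (cube P)) \<in> null_sets \<nu>"
    proof (rule null_sets.Un)
      show "- W \<in> null_sets \<nu>"
        using \<nu>(4) W(2) by (simp add: null_sets_def \<nu>(2))
      show "cube P - interior (cube P) \<in> null_sets \<nu>"
        using \<nu>(3) cube_boundary_null[of P] unfolding absolutely_continuous_def by blast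
    qed
    then have "emeasure \<nu> (- W \<union> (cube P - interior (cube P))) = 0"
      by auto
    also have "emeasure \<nu> (W \<inter> interior (cube P)) + 0 \<le> emeasure \<nu> (\<Union>c\<in>C. cube c)"
      using cover W(2) by (simp, intro emeasure_mono sets.countable_UN'') (auto simp: \<nu>(2))
    also have "\<dots> \<le> (\<integral>\<^sup>+c. emeasure \<nu> (cube c) \<partial>count_space C)"
      by (intro emeasure_UN_le_count_space) (auto simp: \<nu>(2))
    also have "\<dots> \<le> (\<integral>\<^sup>+c. ennreal (A + \<eta>) * ennreal (weight t c)
        + ennreal (1 / \<eta>) * ennreal ((\<delta> c)\<^sup>2 / weight t c) \<partial>count_space C)"
    proof (rule nn_integral_mono)
      fix c assume "c \<in> space (count_space C)"
      then have "\<mu> c \<le> A * weight t c"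
        by (simp add: \<mu>_le)
      then have "measure \<nu> (cube c) \<le> (A + \<eta>) * weight t c + 1 / \<eta> * ((\<delta> c)\<^sup>2 / weight t c)"
        using le_mult_add_square_div[of "weight t c" \<eta> "\<delta> c"] \<eta>
        by (simp add: \<delta>_def distrib_right)
      then have "ennreal (measure \<nu> (cube c)) \<le> ennreal ((A + \<eta>) * weight t c + 1 / \<eta> * ((\<delta> c)\<^sup>2 / weight t c))"
        by (rule ennreal_leI)
      then show "emeasure \<nu> (cube c) \<le> ennreal (A + \<eta>) * ennreal (weight t c)
        + ennreal (1 / \<eta>) * ennreal ((\<delta> c)\<^sup>2 / weight t c)"
        using A \<eta> by (simp add: emeasure_eq_measure less_imp_le flip: ennreal_mult ennreal_plus)
    qed
    also have "\<dots> = ennreal (A + \<eta>) * emeasure (cost t) C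
        + ennreal (1 / \<eta>) * (\<integral>\<^sup>+c. ennreal ((\<delta> c)\<^sup>2 / weight t c) \<partial>count_space C)"
      by (simp add: nn_integral_add nn_integral_cmult emeasure_cost)
    also have "(\<integral>\<^sup>+c. ennreal ((\<delta> c)\<^sup>2 / weight t c) \<partial>count_space C) \<le> D"
    proof -
      have "(\<integral>\<^sup>+c. ennreal ((\<delta> c)\<^sup>2 / weight t c) \<partial>count_space C) =
        (\<integral>\<^sup>+c. ennreal ((\<delta> c)\<^sup>2 / weight t c) * indicator C c \<partial>count_space cube_indices)"
        using C(1) by (auto simp: nn_integral_count_space_indicator indicator_def intro!: nn_integral_cong)
      also have "\<dots> \<le> D"
        unfolding D by (intro nn_integral_mono) (auto simp: indicator_def)
      finally show ?thesis .
    qed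
    also have "D \<le> ennreal (\<eta>\<^sup>2)"
      using \<nu>(5) by (simp add: D_def)
    finally have "ennreal (measure \<nu> (cube P)) \<le> ennreal (A + \<eta>) * emeasure (cost t) C + ennreal (1 / \<eta>) * ennreal (\<eta>\<^sup>2)"
      by (simp add: emeasure_eq_measure add_mono mult_left_mono)
    also have "\<dots> = ennreal ((A + \<eta>) * X + 1 / \<eta> * \<eta>\<^sup>2)"
      using A X \<eta> by (simp add: less_imp_le flip: ennreal_mult ennreal_plus)
    finally have up: "measure \<nu> (cube P) \<le> (A + \<eta>) * X + \<eta>"
      using A X \<eta> by (subst (asm) ennreal_le_iff) (auto simp: power2_eq_square)
    have "ennreal ((\<delta> P)\<^sup>2 / weight t P) \<le> D"
      unfolding D by (rule nn_integral_ge_point) (rule P)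
    also have "D \<le> ennreal (\<eta>\<^sup>2)"
      using \<nu>(5) by (simp add: D_def)
    finally have "(\<delta> P)\<^sup>2 / weight t P \<le> \<eta>\<^sup>2"
      by (simp add: ennreal_le_iff)
    then have "1 / \<eta> * ((\<delta> P)\<^sup>2 / weight t P) \<le> 1 / \<eta> * \<eta>\<^sup>2"
      using \<eta> by (intro mult_left_mono) auto
    then have "\<bar>\<delta> P\<bar> \<le> \<eta> * weight t P + \<eta>"
      using le_mult_add_square_div[of "weight t P" \<eta> "\<delta> P"] \<eta> by (simp add: power2_eq_square)
    moreover have "\<eta> * weight t P \<le> \<eta> * 1"
      using \<eta> weight_le_1[OF t(1), of P] by (intro mult_left_mono) auto
    ultimately have "\<mu> P \<le> measure \<nu> (cube P) + 2 * \<eta>"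
      by (simp add: \<delta>_def)
    then show ?thesis
      using up by (simp add: algebra_simps)
  qed
  have "\<mu> P \<le> A * X"
  proof (rule field_le_epsilon)
    fix e :: real assume "0 < e"
    then show "\<mu> P \<le> A * X + e"
      using bound[of "e / (X + 3)"] X(2) by simp
  qed
  then have "A * weight t P \<le> A * X"
    by (simp add: A_def)
  then have "weight t P \<le> X"
    using A by simp
  then show ?thesis
    by (simp add: X ennreal_leI)
qed simp

lemma almost_uniform_antimono:
  fixes W :: "(real ^ 'n) set"
  assumes "almost_uniform t' W" "t \<le> t'"
  shows "almost_uniform t W"
  unfolding almost_uniform_def
proof (intro allI impI)
  fix e :: real assume "0 < e"
  then obtain \<nu> where \<nu>: "finite_measure \<nu>" "sets \<nu> = sets borel" "absolutely_continuous lborel \<nu>"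
      "emeasure \<nu> (- W) = 0" "discrepancy t' \<nu> \<le> ennreal e"
    using assms(1) unfolding almost_uniform_def by blast
  have "weight t' c \<le> weight t c" for c :: "nat \<times> ('n \<Rightarrow> nat)"
    using assms(2) by (simp add: weight_def mult_right_mono)
  then have "discrepancy t \<nu> \<le> discrepancy t' \<nu>"
    unfolding discrepancy_def
    by (intro nn_integral_mono ennreal_leI divide_left_mono mult_pos_pos) auto
  then show "\<exists>\<nu>. finite_measure \<nu> \<and> sets \<nu> = sets borel \<and> absolutely_continuous lborel \<nu> \<and>
      emeasure \<nu> (- W) = 0 \<and> discrepancy t \<nu> \<le> ennreal e"
    using \<nu> order_trans by blast
qed

lemma finite_level: "finite {c :: nat \<times> ('n::finite \<Rightarrow> nat). c \<in> cube_indices \<and> fst c = l}"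
  and card_level: "card {c :: nat \<times> ('n::finite \<Rightarrow> nat). c \<in> cube_indices \<and> fst c = l} = (2 ^ l) ^ CARD('n)"
proof -
  have eq: "{c :: nat \<times> ('n \<Rightarrow> nat). c \<in> cube_indices \<and> fst c = l} = Pair l ` (PiE UNIV (\<lambda>_. {..<2 ^ l}))"
    by (auto simp: cube_indices_def)
  show "finite {c :: nat \<times> ('n \<Rightarrow> nat). c \<in> cube_indices \<and> fst c = l}"
    unfolding eq by (intro finite_imageI finite_PiE) auto
  show "card {c :: nat \<times> ('n \<Rightarrow> nat). c \<in> cube_indices \<and> fst c = l} = (2 ^ l) ^ CARD('n)"
    unfolding eq by (subst card_image) (auto simp: card_PiE inj_on_def)
qed

text \<open>
  There are \<open>2\<^bsup>ld\<^esup>\<close> cubes of level \<open>l\<close>, so the costs of the levels form a convergent geometric series as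
  soon as the exponent exceeds \<open>d\<close>.
\<close>

lemma cost_cube_indices_finite:
  assumes "real CARD('n::finite) < r"
  shows "emeasure (cost r) (cube_indices :: (nat \<times> ('n \<Rightarrow> nat)) set) < \<infinity>"
proof -
  define L where "L l = {c :: nat \<times> ('n \<Rightarrow> nat). c \<in> cube_indices \<and> fst c = l}" for l
  define q where "q = 2 powr (real CARD('n) - r)"
  have q: "0 < q" "q < 1"
    using assms by (simp_all add: q_def powr_less_one)
  have "emeasure (cost r) (L l) = ennreal (q ^ l)" for l
  proof -
    have "emeasure (cost r) (L l) = (\<Sum>c\<in>L l. ennreal (weight r c))"
      by (simp add: emeasure_cost nn_integral_count_space_finite finite_level L_def)
    also have "\<dots> = (\<Sum>c\<in>L l. ennreal (2 powr (- (r * real l))))"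
      by (intro sum.cong) (auto simp: L_def weight_def)
    also have "\<dots> = ennreal (real ((2 ^ l) ^ CARD('n)) * 2 powr (- (r * real l)))"
      by (simp add: L_def card_level ennreal_mult ennreal_of_nat_eq_real_of_nat)
    also have "real ((2 ^ l) ^ CARD('n)) = 2 powr (real CARD('n) * real l)"
      by (simp add: powr_realpow mult.commute flip: power_mult of_nat_mult)
    also have "2 powr (real CARD('n) * real l) * 2 powr (- (r * real l)) = q ^ l"
      by (simp add: q_def powr_powr algebra_simps flip: powr_add powr_realpow)
    finally show ?thesis .
  qed
  then have "(\<Sum>l. emeasure (cost r) (L l)) = ennreal (\<Sum>l. q ^ l)"
    using q by (simp add: suminf_ennreal2 summable_geometric)
  moreover have "(\<Sum>l. emeasure (cost r) (L l)) = emeasure (cost r) (\<Union>l. L l)"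
    by (intro suminf_emeasure) (auto simp: disjoint_family_on_def L_def)
  moreover have "(\<Union>l. L l) = cube_indices"
    by (auto simp: L_def)
  ultimately show ?thesis
    by simp
qed

section \<open>Countable intersections escape every cheap cover\<close>

lemma openin_torus_Int_interior_cube:
  assumes "openin torus_topology W" "P \<in> cube_indices"
  shows "open (W \<inter> interior (cube P))"
proof -
  have "interior (cube P) \<subseteq> torus"
    using cube_subset_torus[OF assms(2)] interior_subset by blast
  then have "W \<inter> interior (cube P) = torus_proj -` W \<inter> interior (cube P)"
    by (auto simp: subset_iff torus_proj_eq_self_iff[THEN iffD2])
  then show ?thesis
    using assms(1) by (simp add: openin_torus_topology open_Int)
qed

lemma sets_borel_openin_torus:
  assumes "openin torus_topology W"
  shows "W \<in> sets borel"
proof -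
  have "W = torus \<inter> torus_proj -` W"
    using assms by (auto simp: openin_torus_topology torus_proj_eq_self_iff[THEN iffD2] subset_iff)
  moreover have "torus \<inter> torus_proj -` W \<in> sets borel"
    using assms by (intro sets.Int) (auto simp: openin_torus_topology)
  ultimately show ?thesis
    by simp
qed

text \<open>
  One step of the descent. Let \<open>M\<close> be the family of maximal cubes deeper than \<open>P\<close> with closure in \<open>W \<inter> interior (cube P)\<close>;
  they are disjoint and cover this open set. If none of them could serve as \<open>P'\<close>, then each would be
  contained in a member of \<open>R\<close> or would be no more expensive than the members of \<open>R\<close> inside it. Replacing
  in the latter case those members by the cube would produce a cover of \<open>W \<inter> interior (cube P)\<close>
  that costs no more than the part of \<open>R\<close> inside \<open>P\<close>, hence less than \<open>P\<close>, against
  \<open>weight_le_cost_of_cover\<close>.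
\<close>

lemma descend_avoiding_cover:
  fixes W :: "(real ^ 'n) set"
  assumes W: "almost_uniform t W" "openin torus_topology W"
    and t: "0 \<le> t" "t \<le> real CARD('n)"
    and P: "P \<in> cube_indices"
    and R: "R \<subseteq> cube_indices"
    and cheap: "emeasure (cost t) {c \<in> R. (cube c :: (real ^ 'n) set) \<subseteq> cube P} < ennreal (weight t P)"
    and avoid: "\<And>c. c \<in> R \<Longrightarrow> \<not> (cube P :: (real ^ 'n) set) \<subseteq> cube c"
  obtains P' where "P' \<in> cube_indices" "fst P < fst P'"
    "closure (cube P') \<subseteq> W \<inter> interior (cube P)"
    "emeasure (cost t) {c \<in> R. (cube c :: (real ^ 'n) set) \<subseteq> cube P'} < ennreal (weight t P')"
    "\<And>c. c \<in> R \<Longrightarrow> \<not> (cube P' :: (real ^ 'n) set) \<subseteq> cube c"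
proof (rule ccontr)
  note result = that
  assume "\<not> thesis"
  define S where "S = W \<inter> interior (cube P)"
  define inside where "inside a = {c \<in> R. (cube c :: (real ^ 'n) set) \<subseteq> cube a}" for a
  have bad: "(\<exists>c\<in>R. cube a \<subseteq> (cube c :: (real ^ 'n) set)) \<or> ennreal (weight t a) \<le> emeasure (cost t) (inside a)"
    if "a \<in> cube_indices" "fst P < fst a" "closure (cube a) \<subseteq> S" for a
    using \<open>\<not> thesis\<close> result[of a] that unfolding S_def inside_def by (meson not_le)
  have S: "open S" "S \<subseteq> torus" "S \<subseteq> cube P"
    using openin_torus_Int_interior_cube[OF W(2) P] W(2) interior_subset
    by (auto simp: S_def openin_torus_topology)
  define good where "good x n \<longleftrightarrow> fst P < n \<and> closure (cube (address n x)) \<subseteq> S" for x n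
  define n where "n x = (LEAST n. good x n)" for x
  have good_n: "good x (n x)" if x: "x \<in> S" for x
  proof -
    have "\<exists>n. good x n"
      using cube_in_open[OF S(1) x, of "fst P"] S(2) x unfolding good_def by blast
    then show ?thesis
      unfolding n_def by (rule LeastI_ex)
  qed
  \<comment> \<open>The least admissible level at \<open>x\<close> yields the maximal cube around \<open>x\<close>.\<close>
  define M where "M = (\<lambda>x. address (n x) x) ` S"
  have M: "a \<in> cube_indices" "fst P < fst a" "closure (cube a) \<subseteq> S" if a: "a \<in> M" for a
  proof -
    obtain x where "x \<in> S" "a = address (n x) x"
      using a unfolding M_def by blast
    then show "a \<in> cube_indices" "fst P < fst a" "closure (cube a) \<subseteq> S"
      using good_n[of x] S(2) by (auto simp: good_def address_in_cube_indices)
  qed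
  have M_sub: "cube a \<subseteq> (cube P :: (real ^ 'n) set)" if "a \<in> M" for a
    using M(3)[OF that] S(3) closure_subset[of "cube a :: (real ^ 'n) set"] by blast
  have M_cover: "\<exists>a\<in>M. x \<in> cube a" if "x \<in> S" for x
    using that S(2) mem_cube_address unfolding M_def by blast
  have same_address: "address k x = address k z" if "z \<in> cube (address k x)" for x z :: "real ^ 'n" and k
    using address_eq_iff[OF that] by simp
  have M_disj: "a = b" if ab: "a \<in> M" "b \<in> M" "z \<in> cube a" "z \<in> cube b" for a b z
  proof -
    obtain x y where x: "x \<in> S" "a = address (n x) x" and y: "y \<in> S" "b = address (n y) y"
      using ab(1,2) unfolding M_def by blast
    have not_less: "\<not> n x' < n y'"
      if "x' \<in> S" "y' \<in> S" "z \<in> cube (address (n x') x')" "z \<in> cube (address (n y') y')" for x' y'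
    proof
      assume less: "n x' < n y'"
      have y'z: "cube (address (n y') y') \<subseteq> cube (address (n x') x')"
        by (rule cube_nested[OF that(3,4)]) (use less in simp)
      have "y' \<in> cube (address (n x') x')"
        using y'z mem_cube_address[of y' "n y'"] that(2) S(2) by blast
      then have "address (n x') y' = address (n x') x'"
        using same_address by metis
      then have "good y' (n x')"
        using good_n[OF that(1)] by (simp add: good_def)
      then show False
        using less unfolding n_def[of y'] by (metis not_less_Least)
    qed
    have "n x = n y"
      using not_less[OF x(1) y(1)] not_less[OF y(1) x(1)] ab(3,4) x(2) y(2) by (metis linorder_neqE_nat)
    then show "a = b"
      using same_address[of z "n x" x] same_address[of z "n y" y] ab(3,4) x(2) y(2) by metis
  qed
  \<comment> \<open>\<open>A\<close> and \<open>B\<close> form the new cover: members of \<open>R\<close> that swallow a maximal cube, and the remaining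
    maximal cubes.\<close>
  define A where "A = {c \<in> inside P. \<exists>a\<in>M. (cube a :: (real ^ 'n) set) \<subseteq> cube c}"
  define B where "B = {a \<in> M. \<forall>c\<in>R. \<not> (cube a :: (real ^ 'n) set) \<subseteq> cube c}"
  have "ennreal (weight t P) \<le> emeasure (cost t) (A \<union> B)"
  proof (rule weight_le_cost_of_cover[OF W(1) _ t P])
    show "W \<in> sets borel"
      using W(2) by (rule sets_borel_openin_torus)
    show "A \<union> B \<subseteq> cube_indices"
      using R M by (auto simp: A_def B_def inside_def)
    show "cube c \<subseteq> (cube P :: (real ^ 'n) set)" if "c \<in> A \<union> B" for c
      using that M_sub[of c] by (auto simp only: A_def B_def inside_def Un_iff mem_Collect_eq)
    show "W \<inter> interior (cube P) \<subseteq> (\<Union>c\<in>A \<union> B. cube c)"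
    proof
      fix x assume "x \<in> W \<inter> interior (cube P)"
      then have x: "x \<in> S"
        by (simp add: S_def)
      then obtain a where a: "a \<in> M" "x \<in> cube a"
        using M_cover by blast
      show "x \<in> (\<Union>c\<in>A \<union> B. cube c)"
      proof (cases "a \<in> B")
        case False
        then obtain c where c: "c \<in> R" "cube a \<subseteq> (cube c :: (real ^ 'n) set)"
          using a by (auto simp: B_def)
        have "x \<in> cube c" "x \<in> cube P"
          using c(2) a(2) x S(3) by auto
        then have "cube c \<subseteq> (cube P :: (real ^ 'n) set)"
          using cube_nested[of x P c] cube_nested[of x c P] avoid[OF c(1)] by linarith
        then have "c \<in> A"
          using c a by (auto simp: A_def inside_def)
        then show ?thesis
          using \<open>x \<in> cube c\<close> by blast
      qed (use a in blast)
    qed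
  qed
  also have "\<dots> \<le> emeasure (cost t) A + emeasure (cost t) B"
    by (rule emeasure_subadditive) simp_all
  also have "emeasure (cost t) B = (\<integral>\<^sup>+a. ennreal (weight t a) \<partial>count_space B)"
    by (rule emeasure_cost)
  also have "\<dots> \<le> (\<integral>\<^sup>+a. emeasure (cost t) (inside a) \<partial>count_space B)"
    using bad M by (intro nn_integral_mono) (fastforce simp: B_def)
  also have "\<dots> = emeasure (cost t) (\<Union>a\<in>B. inside a)"
  proof (rule emeasure_UN_countable[symmetric])
    show "disjoint_family_on inside B"
      unfolding disjoint_family_on_def
    proof (intro ballI impI equals0I)
      fix a b c assume "a \<in> B" "b \<in> B" "a \<noteq> b" and c: "c \<in> inside a \<inter> inside b"
      moreover obtain z :: "real ^ 'n" where "z \<in> cube c"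
        using cube_nonempty[of c] by blast
      ultimately show False
        using M_disj[of a b z] by (auto simp: B_def inside_def)
    qed
  qed auto
  also have "emeasure (cost t) A + \<dots> = emeasure (cost t) (A \<union> (\<Union>a\<in>B. inside a))"
  proof (rule plus_emeasure)
    show "A \<inter> (\<Union>a\<in>B. inside a) = {}"
    proof (intro equals0I)
      fix c assume "c \<in> A \<inter> (\<Union>a\<in>B. inside a)"
      then obtain a b where ab: "a \<in> M" "cube a \<subseteq> (cube c :: (real ^ 'n) set)" "b \<in> B"
        "cube c \<subseteq> (cube b :: (real ^ 'n) set)" "c \<in> R"
        by (auto simp: A_def inside_def)
      moreover obtain z :: "real ^ 'n" where "z \<in> cube a"
        using cube_nonempty[of a] by blast
      ultimately have "a = b"
        using M_disj[of a b z] by (auto simp: B_def)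
      then show False
        using ab by (auto simp: B_def)
    qed
  qed auto
  also have "\<dots> \<le> emeasure (cost t) (inside P)"
  proof (rule emeasure_mono)
    have "cube a \<subseteq> (cube P :: (real ^ 'n) set)" if "a \<in> B" for a
      using that M_sub[of a] by (simp add: B_def)
    then show "A \<union> (\<Union>a\<in>B. inside a) \<subseteq> inside P"
      unfolding A_def inside_def by blast
  qed auto
  also have "\<dots> < ennreal (weight t P)"
    using cheap by (simp add: inside_def)
  finally show False
    by simp
qed

text \<open>
  Demanding that closures be nested makes the half-open cubes of the descent have a common point. A
  cube of \<open>R\<close> through that point would contain all sufficiently deep cubes of the descent, which the
  descent rules out.
\<close>

lemma ex_not_covered:
  fixes W :: "nat \<Rightarrow> (real ^ 'n) set"
  assumes W: "\<And>n. almost_uniform t (W n)" "\<And>n. openin torus_topology (W n)"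
    and t: "0 \<le> t" "t \<le> real CARD('n)"
    and P: "P \<in> cube_indices"
    and R: "R \<subseteq> cube_indices"
    and cheap: "emeasure (cost t) R < ennreal (weight t P)"
  shows "\<exists>x. x \<in> (\<Inter>n. W n) \<inter> cube P \<and> x \<notin> (\<Union>c\<in>R. cube c)"
proof -
  define I where "I a \<longleftrightarrow> a \<in> cube_indices \<and>
    emeasure (cost t) {c \<in> R. (cube c :: (real ^ 'n) set) \<subseteq> cube a} < ennreal (weight t a) \<and>
    (\<forall>c\<in>R. \<not> (cube a :: (real ^ 'n) set) \<subseteq> cube c)" for a
  have I_P: "I P"
    unfolding I_def
  proof (intro conjI ballI notI P)
    show "emeasure (cost t) {c \<in> R. (cube c :: (real ^ 'n) set) \<subseteq> cube P} < ennreal (weight t P)"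
      by (rule le_less_trans[OF emeasure_mono cheap]) auto
    fix c assume c: "c \<in> R" "(cube P :: (real ^ 'n) set) \<subseteq> cube c"
    have "t * real (fst c) \<le> t * real (fst P)"
      using level_le_of_cube_subset[OF c(2)] t(1) by (intro mult_left_mono) auto
    then have "ennreal (weight t P) \<le> ennreal (weight t c)"
      by (intro ennreal_leI) (simp add: weight_def)
    also have "ennreal (weight t c) \<le> emeasure (cost t) R"
      unfolding emeasure_cost_singleton[symmetric] by (rule emeasure_mono) (use c in auto)
    finally show False
      using cheap by simp
  qed
  have step: "\<exists>b. I b \<and> fst a < fst b \<and> closure (cube b) \<subseteq> W n \<inter> interior (cube a)" if "I a" for a n
  proof -
    have a: "a \<in> cube_indices"
      "emeasure (cost t) {c \<in> R. (cube c :: (real ^ 'n) set) \<subseteq> cube a} < ennreal (weight t a)"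
      "\<And>c. c \<in> R \<Longrightarrow> \<not> (cube a :: (real ^ 'n) set) \<subseteq> cube c"
      using that by (simp_all add: I_def)
    show ?thesis
      by (rule descend_avoiding_cover[OF W(1) W(2) t a(1) R a(2,3), of n]) (unfold I_def, blast+)
  qed
  have "\<exists>p. \<forall>n. (I (p n) \<and> (n = 0 \<longrightarrow> p n = P)) \<and>
    fst (p n) < fst (p (Suc n)) \<and> closure (cube (p (Suc n))) \<subseteq> W n \<inter> interior (cube (p n))"
  proof (rule dependent_nat_choice)
    fix a and n :: nat assume "I a \<and> (n = 0 \<longrightarrow> a = P)"
    then show "\<exists>b. (I b \<and> (Suc n = 0 \<longrightarrow> b = P)) \<and>
      fst a < fst b \<and> closure (cube b) \<subseteq> W n \<inter> interior (cube a)"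
      using step[of a n] by simp
  qed (use I_P in blast)
  then obtain p where p: "p 0 = P" "\<And>n. I (p n)"
    "\<And>n. fst (p n) < fst (p (Suc n)) \<and> closure (cube (p (Suc n))) \<subseteq> W n \<inter> interior (cube (p n))"
    by blast
  have "closure (cube (p (Suc n))) \<subseteq> closure (cube (p n))" for n
    using p(3)[of n] interior_subset closure_subset by blast
  then have dec: "closure (cube (p n)) \<subseteq> closure (cube (p m))" if "m \<le> n" for m n
    by (rule lift_Suc_antimono_le[OF _ that])
  obtain x where x: "x \<in> closure (cube (p n))" for n
  proof (rule bounded_closed_nest[of "\<lambda>n. closure (cube (p n))"])
    show "closure (cube (p n)) \<noteq> {}" for n
      using cube_nonempty[of "p n"] by auto
    show "bounded (closure (cube (p 0)))"
      by (intro bounded_closure bounded_cube)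
  qed (use dec in auto)
  have x_in: "x \<in> cube (p n)" "x \<in> W n" for n
    using x[of "Suc n"] p(3)[of n] interior_subset by blast+
  have level: "n \<le> fst (p n)" for n
    using strict_mono_imp_increasing[of "\<lambda>n. fst (p n)" n] p(3) by (simp add: strict_mono_Suc_iff)
  have "x \<notin> cube c" if "c \<in> R" for c
    using cube_nested[of x c "p (fst c)"] x_in(1) level p(2)[of "fst c"] that unfolding I_def by blast
  then show ?thesis
    using x_in p(1) by blast
qed

section \<open>Translations of the torus\<close>

lemma emeasure_lborel_vimage_translate:
  fixes A :: "('a :: euclidean_space) set"
  assumes "A \<in> sets borel"
  shows "emeasure lborel ((\<lambda>x. x + a) -` A) = emeasure lborel A"
proof -
  have "emeasure lborel A = emeasure (density (distr lborel borel (\<lambda>x. a + x)) (\<lambda>_. 1)) A"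
    using lborel_affine[of 1 a] by simp
  also have "\<dots> = emeasure lborel ((\<lambda>x. x + a) -` A)"
    using assms by (simp add: density_1 emeasure_distr add.commute)
  finally show ?thesis
    by simp
qed

lemma emeasure_lborel_vimage_reflect:
  fixes A :: "('a :: euclidean_space) set"
  assumes "A \<in> sets borel"
  shows "emeasure lborel ((\<lambda>x. a - x) -` A) = emeasure lborel A"
proof -
  have "emeasure lborel A = emeasure (density (distr lborel borel (\<lambda>x. a - x)) (\<lambda>_. 1)) A"
    using lborel_affine[of "- 1" a] by simp
  also have "\<dots> = emeasure lborel ((\<lambda>x. a - x) -` A)"
    using assms by (simp add: density_1 emeasure_distr)
  finally show ?thesis
    by simp
qed

text \<open>
  The translates of \<open>F'\<close> by \<open>G\<close> cut \<open>F\<close> into pieces, and moving every piece into \<open>F'\<close> by the element of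
  \<open>G\<close> that belongs to it preserves both \<open>A\<close> and the measure.
\<close>

lemma emeasure_fundamental_domains:
  fixes A F F' :: "('a :: euclidean_space) set"
  assumes G: "countable G" "\<And>g. g \<in> G \<Longrightarrow> - g \<in> G"
    and meas: "A \<in> sets borel" "F \<in> sets borel" "F' \<in> sets borel"
    and inv: "\<And>g x. g \<in> G \<Longrightarrow> x + g \<in> A \<longleftrightarrow> x \<in> A"
    and F: "\<And>x. \<exists>!g. g \<in> G \<and> x + g \<in> F"
    and F': "\<And>x. \<exists>!g. g \<in> G \<and> x + g \<in> F'"
  shows "emeasure lborel (A \<inter> F) = emeasure lborel (A \<inter> F')"
proof -
  have decomp: "emeasure lborel (A \<inter> F1) = (\<integral>\<^sup>+g. emeasure lborel (A \<inter> F1 \<inter> (\<lambda>x. x + g) -` F2) \<partial>count_space G)"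
    if "F1 \<in> sets borel" "F2 \<in> sets borel" and F2: "\<And>x. \<exists>!g. g \<in> G \<and> x + g \<in> F2" for F1 F2
  proof -
    have ex: "\<exists>g\<in>G. x + g \<in> F2" for x
      using F2[of x] by blast
    have uniq: "g = h" if "g \<in> G" "h \<in> G" "x + g \<in> F2" "x + h \<in> F2" for g h x
      using F2[of x] that by metis
    have "A \<inter> F1 = (\<Union>g\<in>G. A \<inter> F1 \<inter> (\<lambda>x. x + g) -` F2)"
      using ex by auto
    moreover have "disjoint_family_on (\<lambda>g. A \<inter> F1 \<inter> (\<lambda>x. x + g) -` F2) G"
      using uniq unfolding disjoint_family_on_def by auto
    moreover have "(\<lambda>x. x + g) -` F2 \<in> sets borel" for g
      using measurable_sets[of "\<lambda>x. x + g" borel borel F2] that(2) by simp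
    ultimately show ?thesis
      using that(1) meas(1) G(1) by (subst emeasure_UN_countable[symmetric]) auto
  qed
  have "emeasure lborel (A \<inter> F) = (\<integral>\<^sup>+g. emeasure lborel (A \<inter> F \<inter> (\<lambda>x. x + g) -` F') \<partial>count_space G)"
    by (rule decomp[OF meas(2,3) F'])
  also have "\<dots> = (\<integral>\<^sup>+g. emeasure lborel (A \<inter> F' \<inter> (\<lambda>x. x + - g) -` F) \<partial>count_space G)"
  proof (rule nn_integral_cong)
    fix g assume "g \<in> space (count_space G)"
    then have g: "g \<in> G"
      by simp
    have "(\<lambda>x. x + - g) -` F \<in> sets borel"
      using measurable_sets[of "\<lambda>x. x + - g" borel borel F] meas(2) by simp
    then have "emeasure lborel (A \<inter> F' \<inter> (\<lambda>x. x + - g) -` F) =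
      emeasure lborel ((\<lambda>x. x + g) -` (A \<inter> F' \<inter> (\<lambda>x. x + - g) -` F))"
      using meas by (intro emeasure_lborel_vimage_translate[symmetric]) auto
    also have "(\<lambda>x. x + g) -` (A \<inter> F' \<inter> (\<lambda>x. x + - g) -` F) = A \<inter> F \<inter> (\<lambda>x. x + g) -` F'"
      using inv[OF g] by auto
    finally show "emeasure lborel (A \<inter> F \<inter> (\<lambda>x. x + g) -` F') = emeasure lborel (A \<inter> F' \<inter> (\<lambda>x. x + - g) -` F)"
      by simp
  qed
  also have "\<dots> = (\<integral>\<^sup>+g. emeasure lborel (A \<inter> F' \<inter> (\<lambda>x. x + g) -` F) \<partial>count_space G)"
  proof (rule nn_integral_bij_count_space)
    show "bij_betw uminus G G"
      using G(2) by (intro bij_betwI[where g = uminus]) auto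
  qed
  also have "\<dots> = emeasure lborel (A \<inter> F')"
    by (rule decomp[OF meas(3,2) F, symmetric])
  finally show ?thesis .
qed

definition integer_lattice :: "(real ^ 'n) set" where
  "integer_lattice = {z. \<forall>j. z $ j \<in> \<int>}"

lemma countable_lattice: "countable (integer_lattice :: (real ^ 'n) set)"
proof (rule countable_subset)
  show "integer_lattice \<subseteq> range (\<lambda>k :: 'n \<Rightarrow> int. (\<chi> j. real_of_int (k j)))"
  proof
    fix z :: "real ^ 'n" assume "z \<in> integer_lattice"
    then have "z = (\<chi> j. real_of_int \<lfloor>z $ j\<rfloor>)"
      by (simp add: integer_lattice_def vec_eq_iff)
    then show "z \<in> range (\<lambda>k :: 'n \<Rightarrow> int. (\<chi> j. real_of_int (k j)))"
      by (rule range_eqI[of _ _ "\<lambda>j. \<lfloor>z $ j\<rfloor>"])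
  qed
qed simp

lemma ex1_lattice_shift_torus: "\<exists>!z. z \<in> integer_lattice \<and> x + z \<in> torus"
proof (rule ex1I)
  show "- (\<chi> j. real_of_int \<lfloor>x $ j\<rfloor>) \<in> integer_lattice \<and> x + - (\<chi> j. real_of_int \<lfloor>x $ j\<rfloor>) \<in> torus"
    by (auto simp: integer_lattice_def torus_def) linarith+
  fix z assume z: "z \<in> integer_lattice \<and> x + z \<in> torus"
  have "z $ j = - real_of_int \<lfloor>x $ j\<rfloor>" for j
  proof -
    obtain k where k: "z $ j = real_of_int k"
      using z by (auto simp: integer_lattice_def elim: Ints_cases)
    have "0 \<le> x $ j + z $ j" "x $ j + z $ j < 1"
      using z by (auto simp: torus_def)
    then have "\<lfloor>x $ j\<rfloor> = - k"
      unfolding k by (simp add: floor_eq_iff)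
    then show ?thesis
      by (simp add: k)
  qed
  then show "z = - (\<chi> j. real_of_int \<lfloor>x $ j\<rfloor>)"
    by (simp add: vec_eq_iff)
qed

lemma torus_proj_add_lattice: "z \<in> integer_lattice \<Longrightarrow> torus_proj (x + z) = torus_proj x"
  by (auto simp: torus_proj_def integer_lattice_def vec_eq_iff frac_def elim!: Ints_cases dest!: spec)

lemma torus_proj_minus_self_in_lattice: "torus_proj x - x \<in> integer_lattice"
  by (simp add: torus_proj_def integer_lattice_def frac_def)

lemma torus_proj_add_torus_proj: "torus_proj (torus_proj x + y) = torus_proj (x + y)"
  using torus_proj_add_lattice[OF torus_proj_minus_self_in_lattice[of x], of "x + y"]
  by (simp add: algebra_simps)

text \<open>
  Translates and reflections of the unit cube are again fundamental domains of the integer lattice.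
\<close>

lemma emeasure_periodic_torus_shift:
  fixes A :: "(real ^ 'n) set"
  assumes "A \<in> sets borel" "\<And>z x. z \<in> integer_lattice \<Longrightarrow> x + z \<in> A \<longleftrightarrow> x \<in> A"
  shows "emeasure lborel (A \<inter> (\<lambda>x. x + a) -` torus) = emeasure lborel (A \<inter> torus)"
    and "emeasure lborel (A \<inter> (\<lambda>x. a - x) -` torus) = emeasure lborel (A \<inter> torus)"
proof -
  have m: "(\<lambda>x. x + a) -` torus \<in> sets (borel :: (real ^ 'n) measure)" "(\<lambda>x. a - x) -` torus \<in> sets (borel :: (real ^ 'n) measure)"
    using measurable_sets[of "\<lambda>x. x + a" borel borel torus]  measurable_sets[of "\<lambda>x. a - x" borel borel torus]
    by simp_all
  have neg: "- z \<in> integer_lattice" if "z \<in> integer_lattice" for z :: "real ^ 'n"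
    using that by (simp add: integer_lattice_def)
  show "emeasure lborel (A \<inter> (\<lambda>x. x + a) -` torus) = emeasure lborel (A \<inter> torus)"
  proof (rule emeasure_fundamental_domains[OF countable_lattice neg assms(1) m(1) sets_torus assms(2) _ ex1_lattice_shift_torus])
    show "\<exists>!z. z \<in> integer_lattice \<and> x + z \<in> (\<lambda>x. x + a) -` torus" for x
      using ex1_lattice_shift_torus[of "x + a"] by (simp add: ac_simps)
  qed
  show "emeasure lborel (A \<inter> (\<lambda>x. a - x) -` torus) = emeasure lborel (A \<inter> torus)"
  proof (rule emeasure_fundamental_domains[OF countable_lattice neg assms(1) m(2) sets_torus assms(2) _ ex1_lattice_shift_torus])
    show "\<exists>!z. z \<in> integer_lattice \<and> x + z \<in> (\<lambda>x. a - x) -` torus" for x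
    proof -
      have "\<exists>!z. z \<in> integer_lattice \<and> (a - x) + z \<in> torus"
        by (rule ex1_lattice_shift_torus)
      then obtain z where z: "z \<in> integer_lattice" "a - x + z \<in> torus"
        "\<And>z'. z' \<in> integer_lattice \<Longrightarrow> a - x + z' \<in> torus \<Longrightarrow> z' = z"
        by blast
      show ?thesis
      proof (rule ex1I)
        show "- z \<in> integer_lattice \<and> x + - z \<in> (\<lambda>x. a - x) -` torus"
          using z(1,2) neg by (simp add: algebra_simps)
        fix y assume "y \<in> integer_lattice \<and> x + y \<in> (\<lambda>x. a - x) -` torus"
        then have "- y = z"
          by (intro z(3)) (auto simp: neg algebra_simps)
        then show "y = - z"
          by (metis minus_minus)
      qed
    qed
  qed
qed

text \<open>
  This form makes the membership relation jointly measurable in \<open>x\<close> and \<open>v\<close>.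
\<close>

lemma mem_torus_translate:
  assumes "U \<subseteq> torus"
  shows "x \<in> torus_translate U v \<longleftrightarrow> x \<in> torus \<and> torus_proj (x - v) \<in> U"
proof
  assume "x \<in> torus_translate U v"
  then obtain u where u: "u \<in> U" "x = torus_proj (u + v)"
    by (auto simp: torus_translate_def)
  have "torus_proj (x - v) = torus_proj u"
    using torus_proj_add_torus_proj[of "u + v" "- v"] by (simp add: u(2))
  then show "x \<in> torus \<and> torus_proj (x - v) \<in> U"
    using u assms by (auto simp: torus_proj_in_torus torus_proj_eq_self_iff[THEN iffD2] subset_iff)
next
  assume x: "x \<in> torus \<and> torus_proj (x - v) \<in> U"
  have "torus_proj (torus_proj (x - v) + v) = x"
    using x by (simp add: torus_proj_add_torus_proj torus_proj_eq_self_iff)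
  then show "x \<in> torus_translate U v"
    unfolding torus_translate_def using x by (metis imageI)
qed

lemma openin_torus_translate:
  fixes U :: "(real ^ 'n) set"
  assumes "openin torus_topology U"
  shows "openin torus_topology (torus_translate U v)"
proof -
  have U: "U \<subseteq> torus" "open (torus_proj -` U)"
    using assms by (auto simp: openin_torus_topology)
  have "torus_proj -` torus_translate U v = (\<lambda>x. x - v) -` (torus_proj -` U)"
    using torus_proj_add_torus_proj[of _ "- v"] by (auto simp: mem_torus_translate[OF U(1)] torus_proj_in_torus)
  moreover have "open ((\<lambda>x. x - v) -` (torus_proj -` U))"
    by (rule open_vimage[OF U(2)]) (intro continuous_intros)
  moreover have "torus_translate U v \<subseteq> torus"
    using mem_torus_translate[OF U(1)] by blast
  ultimately show ?thesis
    by (simp add: openin_torus_topology)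
qed

lemma measurable_torus_proj [measurable]: "(torus_proj :: real ^ 'n \<Rightarrow> real ^ 'n) \<in> borel_measurable borel"
proof (subst borel_measurable_euclidean_space, intro ballI)
  fix b :: "real ^ 'n" assume "b \<in> Basis"
  then obtain j where b: "b = axis j 1"
    by (auto simp: Basis_vec_def)
  have "(\<lambda>x :: real ^ 'n. x $ j - real_of_int \<lfloor>x $ j\<rfloor>) \<in> borel_measurable borel"
    by measurable
  then show "(\<lambda>x. torus_proj x \<bullet> b) \<in> borel_measurable borel"
    by (simp add: b inner_axis torus_proj_def frac_def)
qed

lemma torus_proj_vimage_periodic:
  "z \<in> integer_lattice \<Longrightarrow> x + z \<in> torus_proj -` U \<longleftrightarrow> x \<in> torus_proj -` U"
  by (simp add: torus_proj_add_lattice)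

lemma torus_proj_vimage_Int_torus: "U \<subseteq> torus \<Longrightarrow> torus_proj -` U \<inter> torus = U"
  by (auto simp: torus_proj_eq_self_iff[THEN iffD2] subset_iff)

lemma sets_torus_proj_vimage:
  "U \<in> sets borel \<Longrightarrow> torus_proj -` U \<in> sets borel"
  using measurable_sets[OF measurable_torus_proj] by simp

lemma emeasure_torus_translate:
  fixes U :: "(real ^ 'n) set"
  assumes U: "U \<subseteq> torus" "U \<in> sets borel"
  shows "emeasure lborel (torus_translate U v) = emeasure lborel U"
proof -
  have "emeasure lborel (torus_translate U v) = emeasure lborel ((\<lambda>x. x + v) -` torus_translate U v)"
  proof (rule emeasure_lborel_vimage_translate[symmetric])
    have "torus_translate U v = torus \<inter> (\<lambda>x. x - v) -` (torus_proj -` U)"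
      using mem_torus_translate[OF U(1)] by auto
    moreover have "(\<lambda>x. x - v) -` (torus_proj -` U) \<in> sets borel"
      using measurable_sets[of "\<lambda>x. x - v" borel borel] sets_torus_proj_vimage[OF U(2)] by simp
    ultimately show "torus_translate U v \<in> sets borel"
      by simp
  qed
  also have "(\<lambda>x. x + v) -` torus_translate U v = torus_proj -` U \<inter> (\<lambda>x. x + v) -` torus"
    by (auto simp: mem_torus_translate[OF U(1)])
  also have "emeasure lborel \<dots> = emeasure lborel (torus_proj -` U \<inter> torus)"
    by (rule emeasure_periodic_torus_shift(1)[OF sets_torus_proj_vimage[OF U(2)] torus_proj_vimage_periodic])
  finally show ?thesis
    by (simp add: torus_proj_vimage_Int_torus U)
qed

text \<open>
  The substitution \<open>w = x - v\<close> turns the set of translations into the part of the periodic extension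
  of \<open>U\<close> inside a reflected unit cube.
\<close>

lemma emeasure_translations_hitting_point:
  fixes U :: "(real ^ 'n) set"
  assumes U: "U \<subseteq> torus" "U \<in> sets borel" and "x \<in> torus"
  shows "emeasure lborel {v \<in> torus. x \<in> torus_translate U v} = emeasure lborel U"
proof -
  let ?B = "{v \<in> torus. x \<in> torus_translate U v}"
  have "emeasure lborel ?B = emeasure lborel ((\<lambda>v. x - v) -` ?B)"
  proof (rule emeasure_lborel_vimage_reflect[symmetric])
    have "?B = torus \<inter> (\<lambda>v. x - v) -` (torus_proj -` U)"
      using mem_torus_translate[OF U(1)] assms(3) by auto
    moreover have "(\<lambda>v. x - v) -` (torus_proj -` U) \<in> sets borel"
      using measurable_sets[of "\<lambda>v. x - v" borel borel] sets_torus_proj_vimage[OF U(2)] by simp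
    ultimately show "?B \<in> sets borel"
      by simp
  qed
  also have "(\<lambda>v. x - v) -` ?B = torus_proj -` U \<inter> (\<lambda>v. x - v) -` torus"
    using assms(3) by (auto simp: mem_torus_translate[OF U(1)])
  also have "emeasure lborel \<dots> = emeasure lborel (torus_proj -` U \<inter> torus)"
    by (rule emeasure_periodic_torus_shift(2)[OF sets_torus_proj_vimage[OF U(2)] torus_proj_vimage_periodic])
  finally show ?thesis
    by (simp add: torus_proj_vimage_Int_torus U)
qed

lemma sets_torus_translate_pair:
  fixes U :: "(real ^ 'n) set"
  assumes U: "U \<subseteq> torus" "U \<in> sets borel"
  shows "{p. snd p \<in> torus_translate U (fst p)} \<in> sets (borel \<Otimes>\<^sub>M borel)"
proof -
  have "{p. snd p \<in> torus_translate U (fst p)} =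
    {p \<in> space (borel \<Otimes>\<^sub>M borel). snd p \<in> torus \<and> torus_proj (snd p - fst p) \<in> U}"
    by (auto simp: mem_torus_translate[OF U(1)] space_pair_measure)
  also have "\<dots> \<in> sets (borel \<Otimes>\<^sub>M borel)"
    using U(2) by measurable
  finally show ?thesis .
qed

section \<open>Averaged overlaps with random translates\<close>

text \<open>
  The variances of independent variables add, since the mixed terms have mean zero.
\<close>

lemma (in prob_space) expectation_square_sum_indep:
  fixes Z :: "'i \<Rightarrow> 'a \<Rightarrow> real"
  assumes I: "finite I" "indep_vars (\<lambda>_. borel) Z I"
    and int: "\<And>i. i \<in> I \<Longrightarrow> integrable M (Z i)" "\<And>i. i \<in> I \<Longrightarrow> integrable M (\<lambda>\<omega>. (Z i \<omega>)\<^sup>2)"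
    and mean: "\<And>i. i \<in> I \<Longrightarrow> expectation (Z i) = 0"
  shows "integrable M (\<lambda>\<omega>. (\<Sum>i\<in>I. Z i \<omega>)\<^sup>2)"
    and "expectation (\<lambda>\<omega>. (\<Sum>i\<in>I. Z i \<omega>)\<^sup>2) = (\<Sum>i\<in>I. expectation (\<lambda>\<omega>. (Z i \<omega>)\<^sup>2))"
proof -
  have sq: "(\<Sum>i\<in>I. Z i \<omega>)\<^sup>2 = (\<Sum>i\<in>I. \<Sum>j\<in>I. Z i \<omega> * Z j \<omega>)" for \<omega>
    by (simp add: power2_eq_square sum_product)
  have prod: "integrable M (\<lambda>\<omega>. Z i \<omega> * Z j \<omega>) \<and>
      expectation (\<lambda>\<omega>. Z i \<omega> * Z j \<omega>) = (if i = j then expectation (\<lambda>\<omega>. (Z i \<omega>)\<^sup>2) else 0)"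
    if "i \<in> I" "j \<in> I" for i j
  proof (cases "i = j")
    case True
    then show ?thesis
      using int(2)[OF that(1)] by (simp add: power2_eq_square)
  next
    case False
    have ind: "indep_vars (\<lambda>_. borel) Z {i, j}"
      using that by (intro indep_vars_subset[OF I(2)]) auto
    show ?thesis
      using indep_vars_lebesgue_integral[OF _ ind] indep_vars_integrable[OF _ ind] int(1) mean that False
      by auto
  qed
  show "integrable M (\<lambda>\<omega>. (\<Sum>i\<in>I. Z i \<omega>)\<^sup>2)"
    unfolding sq using prod by (intro Bochner_Integration.integrable_sum) auto
  have "expectation (\<lambda>\<omega>. (\<Sum>i\<in>I. Z i \<omega>)\<^sup>2) = (\<Sum>i\<in>I. \<Sum>j\<in>I. expectation (\<lambda>\<omega>. Z i \<omega> * Z j \<omega>))"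
    unfolding sq using prod
    by (simp add: Bochner_Integration.integral_sum Bochner_Integration.integrable_sum)
  also have "\<dots> = (\<Sum>i\<in>I. \<Sum>j\<in>I. if i = j then expectation (\<lambda>\<omega>. (Z i \<omega>)\<^sup>2) else 0)"
    using prod by (intro sum.cong) auto
  also have "\<dots> = (\<Sum>i\<in>I. expectation (\<lambda>\<omega>. (Z i \<omega>)\<^sup>2))"
    using I(1) by simp
  finally show "expectation (\<lambda>\<omega>. (\<Sum>i\<in>I. Z i \<omega>)\<^sup>2) = (\<Sum>i\<in>I. expectation (\<lambda>\<omega>. (Z i \<omega>)\<^sup>2))" .
qed

lemma min_le_geometric_mean:
  fixes a b \<theta> :: real
  assumes "0 \<le> a" "0 \<le> b" "0 \<le> \<theta>" "\<theta> \<le> 1"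
  shows "min a b \<le> a powr (1 - \<theta>) * b powr \<theta>"
proof (cases "min a b = 0")
  case False
  then have pos: "0 < min a b"
    using assms by auto
  then have "min a b = min a b powr (1 - \<theta>) * min a b powr \<theta>"
    by (simp flip: powr_add)
  also have "\<dots> \<le> a powr (1 - \<theta>) * b powr \<theta>"
    using assms pos by (intro mult_mono powr_mono2) auto
  finally show ?thesis .
qed simp

text \<open>
  Here \<open>X i\<close> stands for the volume of the intersection of a random translate of volume \<open>u i\<close> with a cube
  of volume \<open>m\<close>. The weights are chosen such that the variance of each summand, at most
  \<open>u\<^sub>i\<^bsup>\<theta>\<^esup> m\<^bsup>1+\<theta>\<^esup> / S\<^sup>2\<close>, is proportional to \<open>u\<^sub>i\<^bsup>\<theta>\<^esup>\<close>, so that the variances add up to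
  \<open>m\<^bsup>1+\<theta>\<^esup> / S\<close>. Variables with
  \<open>u i = 0\<close> take part with weight \<open>0\<close>.
\<close>

lemma (in prob_space) variance_weighted_overlaps:
  fixes X :: "'i \<Rightarrow> 'a \<Rightarrow> real" and u :: "'i \<Rightarrow> real" and m \<theta> :: real
  assumes I: "finite I" "indep_vars (\<lambda>_. borel) X I"
    and X: "\<And>i \<omega>. i \<in> I \<Longrightarrow> 0 \<le> X i \<omega>" "\<And>i \<omega>. i \<in> I \<Longrightarrow> X i \<omega> \<le> u i" "\<And>i \<omega>. i \<in> I \<Longrightarrow> X i \<omega> \<le> m"
    and mean: "\<And>i. i \<in> I \<Longrightarrow> expectation (X i) = u i * m"
    and nonneg: "\<And>i. i \<in> I \<Longrightarrow> 0 \<le> u i" "0 < m" "0 \<le> \<theta>" "\<theta> \<le> 1"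
    and S: "S = (\<Sum>i\<in>I. u i powr \<theta>)" "0 < S"
  shows "(\<integral>\<^sup>+\<omega>. ennreal (((\<Sum>i\<in>I. u i powr (\<theta> - 1) / S * X i \<omega>) - m)\<^sup>2) \<partial>M) \<le> ennreal (m powr (1 + \<theta>) / S)"
proof -
  define b where "b i = u i powr (\<theta> - 1) / S" for i
  define Z where "Z i \<omega> = b i * (X i \<omega> - u i * m)" for i \<omega>
  have meas: "X i \<in> borel_measurable M" if "i \<in> I" for i
    using I(2) that by (simp add: indep_vars_def)
  have bound: "norm (X i \<omega>) \<le> m" if "i \<in> I" for i \<omega>
    using X that by auto
  have int: "integrable M (X i)" if "i \<in> I" for i
    using bound[OF that] by (intro integrable_const_bound[where B = m] meas that) auto
  have int2: "integrable M (\<lambda>\<omega>. (X i \<omega>)\<^sup>2)" if "i \<in> I" for i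
    using power_mono[OF bound[OF that], where n = 2] meas[OF that]
    by (intro integrable_const_bound[where B = "m\<^sup>2"]) auto
  have b_u: "b i * u i = u i powr \<theta> / S" if "i \<in> I" for i
    using nonneg(1)[OF that] powr_mult_base[of "u i" "\<theta> - 1"] by (cases "u i = 0") (auto simp: b_def mult.commute)
  have indZ: "indep_vars (\<lambda>_. borel) Z I"
    unfolding Z_def by (rule indep_vars_compose2[OF I(2)]) auto
  have intZ: "integrable M (Z i)" "integrable M (\<lambda>\<omega>. (Z i \<omega>)\<^sup>2)" "expectation (Z i) = 0" if "i \<in> I" for i
    using int[OF that] int2[OF that] mean[OF that]
    by (auto simp: Z_def[abs_def] power_mult_distrib power2_diff prob_space)
  have varZ: "expectation (\<lambda>\<omega>. (Z i \<omega>)\<^sup>2) \<le> u i powr \<theta> * (m powr (1 + \<theta>) / S\<^sup>2)" if i: "i \<in> I" for i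
  proof -
    have "expectation (\<lambda>\<omega>. (Z i \<omega>)\<^sup>2) = (b i)\<^sup>2 * variance (X i)"
      by (simp add: Z_def power_mult_distrib mean[OF i])
    also have "\<dots> \<le> (b i)\<^sup>2 * expectation (\<lambda>\<omega>. (X i \<omega>)\<^sup>2)"
      using int[OF i] int2[OF i] by (intro mult_left_mono) (auto simp: variance_eq)
    also have "expectation (\<lambda>\<omega>. (X i \<omega>)\<^sup>2) \<le> expectation (\<lambda>\<omega>. u i powr (1 - \<theta>) * m powr \<theta> * X i \<omega>)"
    proof (intro integral_mono int2[OF i] integrable_mult_right int[OF i])
      fix \<omega>
      have "X i \<omega> \<le> min (u i) m"
        using X i by auto
      also have "\<dots> \<le> u i powr (1 - \<theta>) * m powr \<theta>"
        using nonneg i by (intro min_le_geometric_mean) auto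
      finally show "(X i \<omega>)\<^sup>2 \<le> u i powr (1 - \<theta>) * m powr \<theta> * X i \<omega>"
        using X(1)[OF i] by (simp add: power2_eq_square mult_right_mono)
    qed
    also have "\<dots> = u i powr (1 - \<theta>) * m powr \<theta> * (u i * m)"
      using mean[OF i] by simp
    also have "(b i)\<^sup>2 * (u i powr (1 - \<theta>) * m powr \<theta> * (u i * m)) =
        (b i * u i) * (u i powr (1 - \<theta>) * b i) * (m powr \<theta> * m)"
      by (simp add: power2_eq_square)
    also have "\<dots> = u i powr \<theta> / S * (1 / S) * (m powr \<theta> * m)"
    proof (cases "u i = 0")
      case False
      then have "u i powr (1 - \<theta>) * b i = 1 / S"
        using nonneg(1)[OF i] by (simp add: b_def flip: powr_add)
      then show ?thesis
        by (simp add: b_u[OF i])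
    qed (simp add: b_u[OF i])
    also have "\<dots> = u i powr \<theta> * (m powr (1 + \<theta>) / S\<^sup>2)"
      using nonneg by (simp add: powr_add power2_eq_square)
    finally show ?thesis
      by (simp add: mult_left_mono)
  qed
  have "(\<Sum>i\<in>I. b i * u i) = 1"
    using S by (simp add: b_u sum_divide_distrib[symmetric] cong: sum.cong)
  then have "(\<Sum>i\<in>I. b i * X i \<omega>) - m = (\<Sum>i\<in>I. Z i \<omega>)" for \<omega>
    by (simp add: Z_def right_diff_distrib sum_subtractf flip: sum_distrib_right mult.assoc)
  then have "(\<integral>\<^sup>+\<omega>. ennreal (((\<Sum>i\<in>I. b i * X i \<omega>) - m)\<^sup>2) \<partial>M) = (\<integral>\<^sup>+\<omega>. ennreal ((\<Sum>i\<in>I. Z i \<omega>)\<^sup>2) \<partial>M)"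
    by simp
  also have "\<dots> = ennreal (\<Sum>i\<in>I. expectation (\<lambda>\<omega>. (Z i \<omega>)\<^sup>2))"
    using expectation_square_sum_indep[OF I(1) indZ] intZ by (subst nn_integral_eq_integral) auto
  also have "\<dots> \<le> ennreal (\<Sum>i\<in>I. u i powr \<theta> * (m powr (1 + \<theta>) / S\<^sup>2))"
    by (intro ennreal_leI sum_mono varZ)
  also have "(\<Sum>i\<in>I. u i powr \<theta> * (m powr (1 + \<theta>) / S\<^sup>2)) = S * (m powr (1 + \<theta>) / S\<^sup>2)"
    unfolding S(1) by (rule sum_distrib_right[symmetric])
  also have "\<dots> = m powr (1 + \<theta>) / S"
    using S(2) by (simp add: power2_eq_square)
  finally show ?thesis
    by (simp add: b_def)
qed

text \<open>
  By Fubini, the mean overlap is the integral over \<open>x \<in> Q\<close> of the measure of the set of translations that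
  bring \<open>U\<close> onto \<open>x\<close>.
\<close>

lemma
  fixes U Q :: "(real ^ 'n) set"
  assumes U: "U \<subseteq> torus" "U \<in> sets borel" and Q: "Q \<subseteq> torus" "Q \<in> sets borel"
  shows measurable_torus_overlap: "(\<lambda>v. emeasure lborel (torus_translate U v \<inter> Q)) \<in> borel_measurable borel"
    and nn_integral_torus_overlap: "(\<integral>\<^sup>+v. emeasure lborel (torus_translate U v \<inter> Q) \<partial>torus_measure)
      = emeasure lborel U * emeasure lborel Q"
proof -
  let ?H = "{p. snd p \<in> torus_translate U (fst p)} \<inter> (UNIV \<times> Q)"
  have H [measurable]: "?H \<in> sets (borel \<Otimes>\<^sub>M borel)"
    using sets_torus_translate_pair[OF U] Q(2) by (intro sets.Int pair_measureI) auto
  have slice: "Pair v -` ?H = torus_translate U v \<inter> Q" for v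
    by auto
  have "(\<lambda>v. emeasure lborel (Pair v -` ?H)) \<in> borel_measurable borel"
    using H by (intro lborel.measurable_emeasure_Pair) (simp cong: sets_pair_measure_cong)
  then show "(\<lambda>v. emeasure lborel (torus_translate U v \<inter> Q)) \<in> borel_measurable borel"
    unfolding slice .
  have sl [measurable]: "torus_translate U v \<inter> Q \<in> sets borel" for v
    using sets_Pair1[OF H, of v] unfolding slice .
  have "(\<integral>\<^sup>+v. emeasure lborel (torus_translate U v \<inter> Q) \<partial>torus_measure) =
    (\<integral>\<^sup>+v. emeasure lborel (torus_translate U v \<inter> Q) * indicator torus v \<partial>lborel)"
    unfolding torus_measure_def by (subst nn_integral_restrict_space) auto
  also have "\<dots> = (\<integral>\<^sup>+v. \<integral>\<^sup>+x. indicator ?H (v, x) * indicator torus v \<partial>lborel \<partial>lborel)"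
  proof (rule nn_integral_cong)
    fix v
    have "(\<integral>\<^sup>+x. indicator ?H (v, x) * indicator torus v \<partial>lborel) =
      (\<integral>\<^sup>+x. indicator (torus_translate U v \<inter> Q) x * indicator torus v \<partial>lborel)"
      by (intro nn_integral_cong) (auto simp: indicator_def)
    then show "emeasure lborel (torus_translate U v \<inter> Q) * indicator torus v =
      (\<integral>\<^sup>+x. indicator ?H (v, x) * indicator torus v \<partial>lborel)"
      by (simp add: nn_integral_multc)
  qed
  also have "\<dots> = (\<integral>\<^sup>+x. \<integral>\<^sup>+v. indicator ?H (v, x) * indicator torus v \<partial>lborel \<partial>lborel)"
  proof (rule lborel_pair.Fubini'[symmetric])
    show "case_prod (\<lambda>v x. indicator ?H (v, x) * indicator torus v :: ennreal) \<in>
      borel_measurable ((lborel :: (real ^ 'n) measure) \<Otimes>\<^sub>M (lborel :: (real ^ 'n) measure))"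
      unfolding measurable_cong_sets[OF sets_pair_measure_cong[OF sets_lborel sets_lborel] refl] case_prod_beta' prod.collapse
    proof (rule borel_measurable_times_ennreal)
      show "(\<lambda>x. indicator ?H x :: ennreal) \<in> borel_measurable (borel \<Otimes>\<^sub>M borel)"
        using H by (rule borel_measurable_indicator)
      show "(\<lambda>x. indicator torus (fst x) :: ennreal) \<in>
        borel_measurable ((borel :: (real ^ 'n) measure) \<Otimes>\<^sub>M (borel :: (real ^ 'n) measure))"
        by (rule measurable_compose[OF measurable_fst borel_measurable_indicator[OF sets_torus]])
    qed
  qed
  also have "\<dots> = (\<integral>\<^sup>+x. emeasure lborel U * indicator Q x \<partial>lborel)"
  proof (rule nn_integral_cong)
    fix x :: "real ^ 'n"
    have "(\<integral>\<^sup>+v. indicator ?H (v, x) * indicator torus v \<partial>lborel) =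
      (\<integral>\<^sup>+v. indicator {v \<in> torus. x \<in> torus_translate U v} v * indicator Q x \<partial>lborel)"
      by (intro nn_integral_cong) (auto simp: indicator_def)
    also have "\<dots> = emeasure lborel {v \<in> torus. x \<in> torus_translate U v} * indicator Q x"
    proof -
      have "{v \<in> torus. x \<in> torus_translate U v} = torus \<inter> (\<lambda>v. (v, x)) -` {p. snd p \<in> torus_translate U (fst p)}"
        by auto
      also have "\<dots> \<in> sets borel"
        using sets_Pair2[OF sets_torus_translate_pair[OF U], of x] by auto
      finally show ?thesis
        by (simp add: nn_integral_multc)
    qed
    also have "\<dots> = emeasure lborel U * indicator Q x"
      using emeasure_translations_hitting_point[OF U, of x] Q(1) by (auto simp: indicator_def)
    finally show "(\<integral>\<^sup>+v. indicator ?H (v, x) * indicator torus v \<partial>lborel) = emeasure lborel U * indicator Q x" .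
  qed
  also have "\<dots> = emeasure lborel U * emeasure lborel Q"
    using Q(2) by (simp add: nn_integral_cmult)
  finally show "(\<integral>\<^sup>+v. emeasure lborel (torus_translate U v \<inter> Q) \<partial>torus_measure)
      = emeasure lborel U * emeasure lborel Q" .
qed


lemma measure_torus_overlap:
  fixes U Q :: "(real ^ 'n) set"
  assumes U: "U \<subseteq> torus" "U \<in> sets borel" and Q: "Q \<subseteq> torus" "Q \<in> sets borel"
  defines "f \<equiv> \<lambda>v. measure lborel (torus_translate U v \<inter> Q)"
  shows "f \<in> borel_measurable borel" "f v \<le> measure lborel U" "f v \<le> measure lborel Q"
    "integral\<^sup>L torus_measure f = measure lborel U * measure lborel Q"
proof -
  have fin: "emeasure lborel A \<noteq> \<infinity>" if "A \<subseteq> torus" "A \<in> sets borel" for A :: "(real ^ 'n) set"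
    using emeasure_bounded_finite[OF bounded_subset[OF bounded_torus that(1)]] by simp
  have V: "torus_translate U v \<in> sets borel" for v
    using sets_Pair1[OF sets_torus_translate_pair[OF U], of v] by (simp add: vimage_def)
  have V_torus: "torus_translate U v \<subseteq> torus" for v
    using mem_torus_translate[OF U(1)] by blast
  have f_eq: "ennreal (f v) = emeasure lborel (torus_translate U v \<inter> Q)" for v
    using fin[of "torus_translate U v \<inter> Q"] V V_torus Q unfolding f_def
    by (intro emeasure_eq_ennreal_measure[symmetric]) auto
  show meas: "f \<in> borel_measurable borel"
    unfolding f_def measure_def using measurable_torus_overlap[OF U Q] by measurable
  have "ennreal (f v) \<le> emeasure lborel (torus_translate U v)" "ennreal (f v) \<le> emeasure lborel Q"
    unfolding f_eq using V Q by (auto intro!: emeasure_mono)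
  then have "ennreal (f v) \<le> ennreal (measure lborel U)" "ennreal (f v) \<le> ennreal (measure lborel Q)"
    using emeasure_torus_translate[OF U, of v] fin[OF U] fin[OF Q]
    by (simp_all add: emeasure_eq_ennreal_measure)
  then show "f v \<le> measure lborel U" "f v \<le> measure lborel Q"
    by simp_all
  have "integral\<^sup>L torus_measure f = enn2real (\<integral>\<^sup>+v. ennreal (f v) \<partial>torus_measure)"
    using meas by (intro integral_eq_nn_integral)
      (auto simp: f_def torus_measure_def intro: measurable_restrict_space1)
  also have "\<dots> = enn2real (emeasure lborel U * emeasure lborel Q)"
    unfolding f_eq by (simp add: nn_integral_torus_overlap[OF U Q])
  finally show "integral\<^sup>L torus_measure f = measure lborel U * measure lborel Q"
    by (simp add: measure_def enn2real_mult)
qed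

definition overlap_measure :: "nat set \<Rightarrow> (nat \<Rightarrow> real) \<Rightarrow> (nat \<Rightarrow> (real ^ 'n) set) \<Rightarrow> (real ^ 'n) measure" where
  "overlap_measure I b V = density lborel (\<lambda>x. \<Sum>i\<in>I. ennreal (b i) * indicator (V i) x)"

lemma emeasure_overlap_measure:
  assumes "\<And>i. i \<in> I \<Longrightarrow> V i \<in> sets borel" "A \<in> sets borel"
  shows "emeasure (overlap_measure I b V) A = (\<Sum>i\<in>I. ennreal (b i) * emeasure lborel (V i \<inter> A))"
proof -
  have "emeasure (overlap_measure I b V) A = (\<integral>\<^sup>+x. (\<Sum>i\<in>I. ennreal (b i) * indicator (V i) x) * indicator A x \<partial>lborel)"
    unfolding overlap_measure_def using assms by (intro emeasure_density) auto
  also have "\<dots> = (\<integral>\<^sup>+x. (\<Sum>i\<in>I. ennreal (b i) * indicator (V i \<inter> A) x) \<partial>lborel)"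
    by (intro nn_integral_cong) (auto simp: indicator_def sum_distrib_right intro!: sum.cong)
  also have "\<dots> = (\<Sum>i\<in>I. ennreal (b i) * emeasure lborel (V i \<inter> A))"
    using assms by (simp add: nn_integral_sum nn_integral_cmult)
  finally show ?thesis .
qed

text \<open>
  The discrepancy of an average of restrictions of Lebesgue measure is a function of the overlaps alone.
\<close>

lemma almost_uniform_overlapI:
  fixes V :: "nat \<Rightarrow> (real ^ 'n) set"
  assumes V: "\<And>i. i \<in> J \<Longrightarrow> V i \<in> sets borel" "\<And>i. i \<in> J \<Longrightarrow> V i \<subseteq> torus"
    and small: "\<And>e. 0 < e \<Longrightarrow> \<exists>I b. finite I \<and> I \<subseteq> J \<and> (\<forall>i\<in>I. 0 \<le> b i) \<and>
      (\<integral>\<^sup>+c. ennreal (((\<Sum>i\<in>I. b i * measure lborel (V i \<inter> cube c)) - measure lborel (cube c :: (real ^ 'n) set))\<^sup>2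
        / weight t c) \<partial>count_space cube_indices) \<le> ennreal e"
  shows "almost_uniform t (\<Union>i\<in>J. V i)"
  unfolding almost_uniform_def
proof (intro allI impI)
  fix e :: real assume "0 < e"
  from small[OF this] obtain I b where I: "finite I" "I \<subseteq> J" "\<And>i. i \<in> I \<Longrightarrow> 0 \<le> b i"
    and e: "(\<integral>\<^sup>+c. ennreal (((\<Sum>i\<in>I. b i * measure lborel (V i \<inter> cube c)) - measure lborel (cube c :: (real ^ 'n) set))\<^sup>2
        / weight t c) \<partial>count_space cube_indices) \<le> ennreal e"
    by blast
  define \<nu> where "\<nu> = overlap_measure I b V"
  have V': "\<And>i. i \<in> I \<Longrightarrow> V i \<in> sets borel"
    using V(1) I(2) by blast
  have em: "emeasure \<nu> A = ennreal (\<Sum>i\<in>I. b i * measure lborel (V i \<inter> A))" if "A \<in> sets borel" for A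
  proof -
    have "emeasure lborel (V i \<inter> A) = ennreal (measure lborel (V i \<inter> A))" if "i \<in> I" for i
    proof -
      have "V i \<inter> A \<subseteq> torus"
        using V(2) I(2) that by blast
      then show ?thesis
        using emeasure_bounded_finite[OF bounded_subset[OF bounded_torus, of "V i \<inter> A"]]
        by (intro emeasure_eq_ennreal_measure) auto
    qed
    then have "emeasure \<nu> A = (\<Sum>i\<in>I. ennreal (b i * measure lborel (V i \<inter> A)))"
      unfolding \<nu>_def using emeasure_overlap_measure[OF V' that] I(3)
      by (simp add: ennreal_mult)
    then show ?thesis
      using I(3) by simp
  qed
  have sets: "sets \<nu> = sets borel"
    by (simp add: \<nu>_def overlap_measure_def)
  have "finite_measure \<nu>"
    by (rule finite_measureI) (simp add: em sets_eq_imp_space_eq[OF sets])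
  moreover have "absolutely_continuous lborel \<nu>"
    unfolding \<nu>_def overlap_measure_def using V' by (intro absolutely_continuousI_density) auto
  moreover have "emeasure \<nu> (- (\<Union>i\<in>J. V i)) = 0"
  proof -
    have comp: "- (\<Union>i\<in>I. V i) \<in> sets borel"
      using V' I(1) by (intro borel_comp sets.finite_UN) auto
    have "emeasure \<nu> (- (\<Union>i\<in>I. V i)) = 0"
    proof (subst em[OF comp])
      have "V i \<inter> - (\<Union>i\<in>I. V i) = {}" if "i \<in> I" for i
        using that by blast
      then show "ennreal (\<Sum>i\<in>I. b i * measure lborel (V i \<inter> - (\<Union>i\<in>I. V i))) = 0"
        by simp
    qed
    moreover have "emeasure \<nu> (- (\<Union>i\<in>J. V i)) \<le> emeasure \<nu> (- (\<Union>i\<in>I. V i))"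
      using I(2) comp by (intro emeasure_mono) (auto simp only: sets)
    ultimately show ?thesis
      by simp
  qed
  moreover have "measure \<nu> (cube c) = (\<Sum>i\<in>I. b i * measure lborel (V i \<inter> cube c))" for c
    using I(3) by (simp add: measure_def em sum_nonneg)
  then have "discrepancy t \<nu> \<le> ennreal e"
    using e by (simp add: discrepancy_def)
  ultimately show "\<exists>\<nu>. finite_measure \<nu> \<and> sets \<nu> = sets borel \<and>
     absolutely_continuous lborel \<nu> \<and> emeasure \<nu> (- (\<Union>i\<in>J. V i)) = 0 \<and> discrepancy t \<nu> \<le> ennreal e"
    using sets by blast
qed

lemma partial_sums_unbounded_of_not_summable:
  fixes f :: "nat \<Rightarrow> real"
  assumes "\<not> f summable_on {1..}" "\<And>i. 0 \<le> f i"
  shows "\<exists>N. B < (\<Sum>i\<in>{n..N}. f i)"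
proof (rule ccontr)
  assume "\<not> (\<exists>N. B < (\<Sum>i\<in>{n..N}. f i))"
  then have B: "(\<Sum>i\<in>{n..N}. f i) \<le> B" for N
    by (simp add: not_less)
  have "f summable_on {1..}"
  proof (rule nonneg_bdd_above_summable_on)
    show "bdd_above (sum f ` {F. F \<subseteq> {1..} \<and> finite F})"
    proof (rule bdd_aboveI2)
      fix F :: "nat set" assume "F \<in> {F. F \<subseteq> {1..} \<and> finite F}"
      then obtain N where "F \<subseteq> {..N}"
        by (auto simp: finite_nat_set_iff_bounded_le)
      then have "sum f F \<le> sum f ({..<n} \<union> {n..N})"
        using assms(2) by (intro sum_mono2) auto
      also have "\<dots> = sum f {..<n} + sum f {n..N}"
        by (intro sum.union_disjoint) auto
      also have "\<dots> \<le> sum f {..<n} + B"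
        using B by simp
      finally show "sum f F \<le> sum f {..<n} + B" .
    qed
  qed (use assms(2) in auto)
  then show False
    using assms(1) by simp
qed

section \<open>Unions of random translates are almost uniform\<close>

text \<open>
  By \<open>variance_weighted_overlaps\<close> the expected discrepancy of the averages over the indices from \<open>n\<close> to \<open>N\<close>
  is at most \<open>K / S N\<close>, where \<open>K\<close> is the total cost of all cubes for the exponent \<open>d + \<tau> - t > d\<close>. Hence the
  infimum over \<open>N\<close> of these discrepancies has mean zero, as the sums \<open>S N\<close> are unbounded.
\<close>

lemma (in prob_space) AE_almost_uniform_union:
  fixes U :: "nat \<Rightarrow> (real ^ 'n) set" and v :: "nat \<Rightarrow> 'a \<Rightarrow> real ^ 'n"
  assumes U: "\<And>i. i \<ge> 1 \<Longrightarrow> openin torus_topology (U i)"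
    and indep: "indep_vars (\<lambda>_. torus_measure) v {1..}"
    and distr: "\<And>i. i \<ge> 1 \<Longrightarrow> distr M torus_measure (v i) = torus_measure"
    and t: "t < \<tau>" "0 < \<tau>" "\<tau> \<le> real CARD('n)"
    and diverges: "\<not> (\<lambda>i. measure torus_measure (U i) powr (\<tau> / real CARD('n))) summable_on {1..}"
    and n: "n \<ge> 1"
  shows "AE \<omega> in M. almost_uniform t (\<Union>i\<in>{n..}. torus_translate (U i) (v i \<omega>))"
proof -
  define d where "d = real CARD('n)"
  define \<theta> where "\<theta> = \<tau> / d"
  define u where "u i = measure torus_measure (U i)" for i
  define m where "m c = measure lborel (cube c :: (real ^ 'n) set)" for c :: "nat \<times> ('n \<Rightarrow> nat)"
  define f where "f c i w = measure lborel (torus_translate (U i) w \<inter> cube c)" for c i w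
  define S where "S N = (\<Sum>i\<in>{n..N}. u i powr \<theta>)" for N
  define b where "b N i = u i powr (\<theta> - 1) / S N" for N i
  define D where "D N \<omega> = (\<integral>\<^sup>+c. ennreal (((\<Sum>i\<in>{n..N}. b N i * f c i (v i \<omega>)) - m c)\<^sup>2 / weight t c)
    \<partial>count_space cube_indices)" for N \<omega>
  define K where "K = emeasure (cost (d + \<tau> - t)) (cube_indices :: (nat \<times> ('n \<Rightarrow> nat)) set)"
  have d: "0 < d"
    by (simp add: d_def)
  have \<theta>: "0 \<le> \<theta>" "\<theta> \<le> 1"
    using t d by (simp_all add: \<theta>_def d_def)
  have U': "U i \<subseteq> torus" "U i \<in> sets borel" if "i \<ge> 1" for i
    using U[OF that] by (auto simp: openin_torus_topology sets_borel_openin_torus[OF U[OF that]])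
  have u_eq: "u i = measure lborel (U i)" if "i \<ge> 1" for i
    unfolding u_def torus_measure_def using U'[OF that] by (subst measure_restrict_space) auto
  have cube': "cube c \<subseteq> (torus :: (real ^ 'n) set)" if "c \<in> cube_indices" for c
    using that by (rule cube_subset_torus)
  have rv [measurable]: "v i \<in> measurable M torus_measure" if "i \<ge> 1" for i
    using indep that by (simp add: indep_vars_def)
  have f_meas: "f c i \<in> borel_measurable torus_measure" if "c \<in> cube_indices" "i \<ge> 1" for c i
    unfolding f_def torus_measure_def
    by (intro measurable_restrict_space1) (simp add: measure_torus_overlap(1)[OF U'[OF that(2)] cube'[OF that(1)] sets_cube])
  have fv_meas: "(\<lambda>\<omega>. f c i (v i \<omega>)) \<in> borel_measurable M" if "c \<in> cube_indices" "i \<ge> 1" for c i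
    using measurable_compose[OF rv[OF that(2)] f_meas[OF that]] .
  have second_moment: "(\<integral>\<^sup>+\<omega>. ennreal (((\<Sum>i\<in>{n..N}. b N i * f c i (v i \<omega>)) - m c)\<^sup>2) \<partial>M)
      \<le> ennreal (m c powr (1 + \<theta>) / S N)" if c: "c \<in> cube_indices" and N: "0 < S N" for c N
    unfolding b_def
  proof (rule variance_weighted_overlaps)
    show "indep_vars (\<lambda>_. borel) (\<lambda>i \<omega>. f c i (v i \<omega>)) {n..N}"
      by (rule indep_vars_compose2[OF indep_vars_subset[OF indep]]) (use n f_meas[OF c] in auto)
    fix i assume "i \<in> {n..N}"
    then have i: "i \<ge> 1"
      using n by simp
    note overlap = measure_torus_overlap[OF U'[OF i] cube'[OF c] sets_cube]
    show "f c i (v i \<omega>) \<le> u i" "f c i (v i \<omega>) \<le> m c" for \<omega>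
      using overlap(2,3) by (simp_all add: f_def m_def u_eq[OF i])
    have "expectation (\<lambda>\<omega>. f c i (v i \<omega>)) = integral\<^sup>L (distr M torus_measure (v i)) (f c i)"
      by (rule integral_distr[OF rv[OF i] f_meas[OF c i], symmetric])
    also have "\<dots> = u i * m c"
      unfolding distr[OF i] using overlap(4) by (simp add: f_def[abs_def] m_def u_eq[OF i])
    finally show "expectation (\<lambda>\<omega>. f c i (v i \<omega>)) = u i * m c" .
  qed (use \<theta> N in \<open>auto simp: f_def u_def m_def measure_cube S_def\<close>)
  have sq_meas: "(\<lambda>\<omega>. ((\<Sum>i\<in>{n..N}. b N i * f c i (v i \<omega>)) - m c)\<^sup>2) \<in> borel_measurable M"
    if "c \<in> cube_indices" for c N
    using n by (intro borel_measurable_power borel_measurable_diff borel_measurable_sum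
        borel_measurable_times fv_meas[OF that]) auto
  have term_meas: "(\<lambda>\<omega>. ennreal (((\<Sum>i\<in>{n..N}. b N i * f c i (v i \<omega>)) - m c)\<^sup>2 / weight t c)) \<in> borel_measurable M"
    if "c \<in> cube_indices" for c N
    using sq_meas[OF that, of N] by measurable
  have D_meas: "D N \<in> borel_measurable M" for N
  proof -
    interpret C: sigma_finite_measure "count_space (cube_indices :: (nat \<times> ('n \<Rightarrow> nat)) set)"
      by (rule sigma_finite_measure_count_space_countable) auto
    show ?thesis
      unfolding D_def
    proof (rule C.borel_measurable_nn_integral)
      show "(\<lambda>(\<omega>, c). ennreal (((\<Sum>i\<in>{n..N}. b N i * f c i (v i \<omega>)) - m c)\<^sup>2 / weight t c))
        \<in> borel_measurable (M \<Otimes>\<^sub>M count_space cube_indices)"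
        unfolding case_prod_beta'
        by (rule measurable_compose_countable'[where f = "\<lambda>c p. _ c (fst p)" and g = snd and I = cube_indices])
          (auto intro: measurable_compose[OF measurable_fst term_meas])
    qed
  qed
  have D_le: "(\<integral>\<^sup>+\<omega>. D N \<omega> \<partial>M) \<le> ennreal (1 / S N) * K" if N: "0 < S N" for N
  proof -
    have "(\<integral>\<^sup>+\<omega>. D N \<omega> \<partial>M) = (\<integral>\<^sup>+c. \<integral>\<^sup>+\<omega>. ennreal (((\<Sum>i\<in>{n..N}. b N i * f c i (v i \<omega>)) - m c)\<^sup>2 / weight t c)
        \<partial>M \<partial>count_space cube_indices)"
      unfolding D_def by (rule nn_integral_count_space_nn_integral) (use term_meas in auto)
    also have "\<dots> \<le> (\<integral>\<^sup>+c. ennreal (1 / S N) * ennreal (weight (d + \<tau> - t) c)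
        \<partial>count_space (cube_indices :: (nat \<times> ('n \<Rightarrow> nat)) set))"
    proof (rule nn_integral_mono)
      fix c :: "nat \<times> ('n \<Rightarrow> nat)" assume "c \<in> space (count_space cube_indices)"
      then have c: "c \<in> cube_indices"
        by simp
      let ?y = "\<lambda>\<omega>. ((\<Sum>i\<in>{n..N}. b N i * f c i (v i \<omega>)) - m c)\<^sup>2"
      have "(\<integral>\<^sup>+\<omega>. ennreal (?y \<omega> / weight t c) \<partial>M) = (\<integral>\<^sup>+\<omega>. ennreal (1 / weight t c) * ennreal (?y \<omega>) \<partial>M)"
        by (simp add: less_imp_le flip: ennreal_mult)
      also have "\<dots> = ennreal (1 / weight t c) * (\<integral>\<^sup>+\<omega>. ennreal (?y \<omega>) \<partial>M)"
        by (rule nn_integral_cmult[OF measurable_compose[OF sq_meas[OF c] measurable_ennreal]])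
      also have "\<dots> \<le> ennreal (1 / weight t c) * ennreal (m c powr (1 + \<theta>) / S N)"
        by (intro mult_left_mono second_moment[OF c N]) simp
      also have "m c powr (1 + \<theta>) = weight (d + \<tau> - t) c * weight t c"
      proof -
        have "m c powr (1 + \<theta>) = 2 powr (- (d * real (fst c)) * (1 + \<theta>))"
          by (simp add: m_def measure_cube_powr d_def powr_powr)
        also have "- (d * real (fst c)) * (1 + \<theta>) = - ((d + \<tau> - t) * real (fst c)) + - (t * real (fst c))"
          using d by (simp add: \<theta>_def field_simps)
        finally show ?thesis
          by (simp only: weight_def powr_add)
      qed
      also have "ennreal (1 / weight t c) * ennreal (weight (d + \<tau> - t) c * weight t c / S N) =
          ennreal (1 / S N) * ennreal (weight (d + \<tau> - t) c)"
        using N weight_pos[of t c, THEN less_imp_neq, symmetric] by (simp add: less_imp_le flip: ennreal_mult)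
      finally show "(\<integral>\<^sup>+\<omega>. ennreal (?y \<omega> / weight t c) \<partial>M) \<le> ennreal (1 / S N) * ennreal (weight (d + \<tau> - t) c)" .
    qed
    also have "\<dots> = ennreal (1 / S N) * K"
      by (simp add: nn_integral_cmult K_def emeasure_cost)
    finally show ?thesis .
  qed
  have K: "K < \<infinity>"
    unfolding K_def using t by (intro cost_cube_indices_finite) (simp add: d_def)
  have "(\<integral>\<^sup>+\<omega>. (INF N. D N \<omega>) \<partial>M) \<le> 0"
  proof (rule ennreal_le_epsilon)
    fix e :: real assume e: "0 < e"
    define k where "k = enn2real K"
    have k: "K = ennreal k" "0 \<le> k"
      using K by (simp_all add: k_def)
    obtain N where N: "k / e < S N"
      unfolding S_def using partial_sums_unbounded_of_not_summable[of "\<lambda>i. u i powr \<theta>" "k / e" n] diverges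
      by (auto simp: u_def \<theta>_def d_def)
    have "0 \<le> k / e"
      using k(2) e by simp
    then have S_pos: "0 < S N"
      using N by simp
    have "(\<integral>\<^sup>+\<omega>. (INF N. D N \<omega>) \<partial>M) \<le> (\<integral>\<^sup>+\<omega>. D N \<omega> \<partial>M)"
      by (intro nn_integral_mono INF_lower) simp
    also have "\<dots> \<le> ennreal (1 / S N) * ennreal k"
      using D_le[OF S_pos] by (simp add: k)
    also have "\<dots> = ennreal (k / S N)"
      using k(2) S_pos by (simp flip: ennreal_mult)
    also have "\<dots> \<le> ennreal e"
      using N S_pos e by (intro ennreal_leI) (simp add: field_simps)
    finally show "(\<integral>\<^sup>+\<omega>. (INF N. D N \<omega>) \<partial>M) \<le> 0 + ennreal e"
      by simp
  qed
  then have "AE \<omega> in M. (INF N. D N \<omega>) = 0"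
    using D_meas by (subst nn_integral_0_iff_AE[symmetric]) auto
  then show ?thesis
  proof (rule AE_mp, intro AE_I2 impI)
    fix \<omega> assume zero: "(INF N. D N \<omega>) = 0"
    show "almost_uniform t (\<Union>i\<in>{n..}. torus_translate (U i) (v i \<omega>))"
    proof (rule almost_uniform_overlapI)
      fix i assume "i \<in> {n..}"
      then have "openin torus_topology (torus_translate (U i) (v i \<omega>))"
        using n by (intro openin_torus_translate U) simp
      then show "torus_translate (U i) (v i \<omega>) \<in> sets borel" "torus_translate (U i) (v i \<omega>) \<subseteq> torus"
        by (simp_all add: sets_borel_openin_torus openin_torus_topology)
    next
      fix e :: real assume "0 < e"
      then have "(INF N. D N \<omega>) < ennreal e"
        by (simp add: zero)
      then obtain N where "D N \<omega> < ennreal e"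
        by (auto simp: INF_less_iff)
      moreover have "0 \<le> b N i" for i
        by (simp add: b_def S_def sum_nonneg)
      ultimately show "\<exists>I b. finite I \<and> I \<subseteq> {n..} \<and> (\<forall>i\<in>I. 0 \<le> b i) \<and>
        (\<integral>\<^sup>+c. ennreal (((\<Sum>i\<in>I. b i * measure lborel (torus_translate (U i) (v i \<omega>) \<inter> cube c)) -
          measure lborel (cube c :: (real ^ 'n) set))\<^sup>2 / weight t c) \<partial>count_space cube_indices) \<le> ennreal e"
        by (intro exI[of _ "{n..N}"] exI[of _ "b N"]) (auto simp: D_def f_def m_def less_imp_le)
    qed
  qed
qed

section \<open>Net content of countable intersections\<close>

lemma nn_integral_count_space_le_infsum:
  fixes g :: "nat \<Rightarrow> ennreal"
  shows "(\<integral>\<^sup>+j. g j \<partial>count_space J) \<le> (\<Sum>\<^sub>\<infinity>j\<in>J. g j)"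
proof -
  have "(\<integral>\<^sup>+j. g j \<partial>count_space J) = (\<Sum>j. g j * indicator J j)"
    by (simp add: nn_integral_count_space_indicator nn_integral_count_space_nat)
  also have "\<dots> = (SUP n. \<Sum>j<n. g j * indicator J j)"
    by (simp add: suminf_eq_SUP)
  also have "\<dots> \<le> (\<Sum>\<^sub>\<infinity>j\<in>J. g j)"
  proof (rule SUP_least)
    fix n
    have "(\<Sum>j<n. g j * indicator J j) = (\<Sum>j\<in>{..<n} \<inter> J. g j)"
      by (simp add: sum.inter_restrict indicator_def of_bool_def if_distrib cong: if_cong)
    also have "\<dots> \<le> (\<Sum>\<^sub>\<infinity>j\<in>J. g j)"
      by (subst nonneg_infsum_complete) (auto intro!: SUP_upper)
    finally show "(\<Sum>j<n. g j * indicator J j) \<le> (\<Sum>\<^sub>\<infinity>j\<in>J. g j)" .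
  qed
  finally show ?thesis .
qed

lemma diameter_cube_powr:
  "diameter (cube c :: (real ^ 'n) set) powr t = diameter (torus :: (real ^ 'n) set) powr t * weight t c"
proof -
  have "diameter (cube c :: (real ^ 'n) set) = diameter (torus :: (real ^ 'n) set) * 2 powr - real (fst c)"
    by (simp add: diameter_cube powr_minus powr_realpow divide_inverse)
  then show ?thesis
    using diameter_torus_pos[where 'n = 'n]
    by (simp add: powr_mult powr_powr weight_def mult.commute)
qed

lemma net_content_mono: "A \<subseteq> B \<Longrightarrow> net_content t A \<le> net_content t B"
  unfolding net_content_def by (intro Inf_superset_mono) blast

lemma net_content_cube_le:
  assumes "Q \<in> dyadic_cubes"
  shows "net_content t Q \<le> ennreal (diameter Q powr t)"
  unfolding net_content_def
proof (rule Inf_lower)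
  show "ennreal (diameter Q powr t) \<in> {(\<Sum>\<^sub>\<infinity>j\<in>J. ennreal (diameter (Q' j) powr t)) | (J :: nat set) Q'.
         (\<forall>j\<in>J. Q' j \<in> dyadic_cubes) \<and> Q \<subseteq> (\<Union>j\<in>J. Q' j)}"
    using assms by (intro CollectI exI[of _ "{0 :: nat}"] exI[of _ "\<lambda>_. Q"]) auto
qed

text \<open>
  A cover of smaller total \<open>t\<close>-diameter would be cheaper than \<open>Q\<close> and so would miss a point of the
  intersection. Repetitions in the cover only add to its total.
\<close>

lemma net_content_Inter_ge:
  fixes W :: "nat \<Rightarrow> (real ^ 'n) set"
  assumes W: "\<And>n. almost_uniform t (W n)" "\<And>n. openin torus_topology (W n)"
    and t: "0 \<le> t" "t \<le> real CARD('n)"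
    and Q: "Q \<in> dyadic_cubes"
  shows "ennreal (diameter Q powr t) \<le> net_content t ((\<Inter>n. W n) \<inter> Q)"
  unfolding net_content_def
proof (rule Inf_greatest, clarify)
  fix J :: "nat set" and C :: "nat \<Rightarrow> (real ^ 'n) set"
  assume C: "\<forall>j\<in>J. C j \<in> dyadic_cubes" and cover: "(\<Inter>n. W n) \<inter> Q \<subseteq> (\<Union>j\<in>J. C j)"
  obtain P where P: "P \<in> cube_indices" "Q = cube P"
    using Q unfolding dyadic_cubes_eq by blast
  have "\<forall>j\<in>J. \<exists>c\<in>cube_indices. C j = cube c"
    using C unfolding dyadic_cubes_eq by blast
  then obtain c where c: "\<And>j. j \<in> J \<Longrightarrow> c j \<in> cube_indices" "\<And>j. j \<in> J \<Longrightarrow> C j = cube (c j)"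
    by metis
  define k where "k = diameter (torus :: (real ^ 'n) set) powr t"
  have k: "0 < k"
    using diameter_torus_pos[where 'n = 'n] by (simp add: k_def)
  show "ennreal (diameter Q powr t) \<le> (\<Sum>\<^sub>\<infinity>j\<in>J. ennreal (diameter (C j) powr t))"
  proof (rule ccontr)
    assume "\<not> ?thesis"
    then have "(\<Sum>\<^sub>\<infinity>j\<in>J. ennreal (diameter (C j) powr t)) < ennreal (diameter Q powr t)"
      by simp
    moreover have "ennreal k * emeasure (cost t) (c ` J) \<le> (\<Sum>\<^sub>\<infinity>j\<in>J. ennreal (diameter (C j) powr t))"
    proof -
      have "emeasure (cost t) (c ` J) = emeasure (cost t) (\<Union>j\<in>J. {c j})"
        by (simp add: UNION_singleton_eq_range)
      also have "\<dots> \<le> (\<integral>\<^sup>+j. emeasure (cost t) {c j} \<partial>count_space J)"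
        by (rule emeasure_UN_le_count_space) auto
      finally have "ennreal k * emeasure (cost t) (c ` J) \<le> ennreal k * (\<integral>\<^sup>+j. ennreal (weight t (c j)) \<partial>count_space J)"
        unfolding emeasure_cost_singleton by (rule mult_left_mono) simp
      also have "\<dots> = (\<integral>\<^sup>+j. ennreal (diameter (C j) powr t) \<partial>count_space J)"
        unfolding nn_integral_cmult[OF borel_measurable_count_space, symmetric]
        using c(2) k by (intro nn_integral_cong) (auto simp: diameter_cube_powr k_def ennreal_mult less_imp_le)
      also have "\<dots> \<le> (\<Sum>\<^sub>\<infinity>j\<in>J. ennreal (diameter (C j) powr t))"
        by (rule nn_integral_count_space_le_infsum)
      finally show ?thesis .
    qed
    ultimately have "ennreal k * emeasure (cost t) (c ` J) < ennreal k * ennreal (weight t P)"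
      using k by (simp add: P diameter_cube_powr k_def ennreal_mult less_imp_le)
    then have cheap: "emeasure (cost t) (c ` J) < ennreal (weight t P)"
      by (meson mult_left_mono not_le zero_le)
    have "\<exists>x. x \<in> (\<Inter>n. W n) \<inter> cube P \<and> x \<notin> (\<Union>a\<in>c ` J. cube a)"
      by (rule ex_not_covered[OF W t P(1) _ cheap]) (use c(1) in auto)
    then obtain x where x: "x \<in> (\<Inter>n. W n) \<inter> cube P" "x \<notin> (\<Union>a\<in>c ` J. cube a)"
      by (elim exE conjE)
    have "x \<in> (\<Union>j\<in>J. C j)"
      by (rule subsetD[OF cover]) (simp only: P(2) x(1))
    moreover have "(\<Union>a\<in>c ` J. cube a) = (\<Union>j\<in>J. C j)"
      using c(2) by simp
    ultimately show False
      using x(2) by (simp only: simp_thms)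
  qed
qed

section \<open>Random limsup sets have large intersections\<close>

theorem corollary2:
  fixes M :: "'w measure"
    and U :: "nat \<Rightarrow> (real ^ 'n) set"
    and v :: "nat \<Rightarrow> 'w \<Rightarrow> real ^ 'n"
    and s :: real
  assumes "prob_space M"
    and "\<And>i. i \<ge> 1 \<Longrightarrow> openin torus_topology (U i)"
    and "prob_space.indep_vars M (\<lambda>_. torus_measure) v {1..}"
    and "\<And>i. i \<ge> 1 \<Longrightarrow> distr M torus_measure (v i) = torus_measure"
    and "s = Inf {t. 0 < t \<and> t \<le> real CARD('n) \<and>
               ((\<lambda>i. measure torus_measure (U i) powr (t / real CARD('n))) summable_on {1..}
                \<or> t = real CARD('n))}"
  shows "AE \<omega> in M. (\<Inter>n\<in>{1..}. \<Union>i\<in>{n..}. torus_translate (U i) (v i \<omega>))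
                     \<in> large_intersection_class s"
proof -
  interpret prob_space M by fact
  define A where "A = {t. 0 < t \<and> t \<le> real CARD('n) \<and>
               ((\<lambda>i. measure torus_measure (U i) powr (t / real CARD('n))) summable_on {1..}
                \<or> t = real CARD('n))}"
  define W where "W n \<omega> = (\<Union>i\<in>{Suc n..}. torus_translate (U i) (v i \<omega>))" for n \<omega>
  \<comment> \<open>Exponents tending to \<open>s\<close> from below; countably many suffice, as almost uniformity is inherited by
    smaller exponents.\<close>
  define r where "r k = s * real k / (real k + 1)" for k :: nat
  have bdd: "bdd_below A"
    by (rule bdd_belowI[of _ 0]) (auto simp: A_def)
  have s_le: "s \<le> \<tau>" if "\<tau> \<in> A" for \<tau>
    unfolding assms(5) A_def[symmetric] by (rule cInf_lower[OF that bdd])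
  have s_d: "s \<le> real CARD('n)"
    by (rule s_le) (simp add: A_def)
  have W_open: "openin torus_topology (W n \<omega>)" for n \<omega>
  proof -
    have "openin torus_topology (torus_translate (U i) (v i \<omega>))" if "Suc n \<le> i" for i
      using that by (intro openin_torus_translate assms(2)) simp
    then show ?thesis
      unfolding W_def by (intro openin_Union) auto
  qed
  have limsup: "(\<Inter>n\<in>{1..}. \<Union>i\<in>{n..}. torus_translate (U i) (v i \<omega>)) = (\<Inter>n. W n \<omega>)" for \<omega>
  proof -
    have "{1..} = range Suc"
      by (auto simp: image_iff Suc_le_eq gr0_conv_Suc)
    then show ?thesis
      by (simp add: W_def)
  qed
  have "AE \<omega> in M. \<forall>n k. 0 < s \<longrightarrow> almost_uniform (r k) (W n \<omega>)"
    unfolding AE_all_countable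
  proof (intro allI)
    fix n k
    show "AE \<omega> in M. 0 < s \<longrightarrow> almost_uniform (r k) (W n \<omega>)"
    proof (cases "0 < s")
      case True
      define \<tau> where "\<tau> = (r k + s) / 2"
      have "r k < s"
        using True by (simp add: r_def field_simps)
      moreover have "0 \<le> r k"
        using True by (simp add: r_def)
      ultimately have \<tau>: "r k < \<tau>" "0 < \<tau>" "\<tau> < s"
        using True by (simp_all add: \<tau>_def)
      then have "\<tau> \<notin> A"
        using s_le[of \<tau>] by auto
      then have "\<not> (\<lambda>i. measure torus_measure (U i) powr (\<tau> / real CARD('n))) summable_on {1..}"
        using \<tau> s_d by (auto simp: A_def)
      then show ?thesis
        using AE_almost_uniform_union[OF assms(2-4) \<tau>(1,2), where n = "Suc n"] \<tau> s_d
        by (simp add: W_def)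
    qed simp
  qed
  then show ?thesis
  proof (rule AE_mp, intro AE_I2 impI)
    fix \<omega> assume uniform: "\<forall>n k. 0 < s \<longrightarrow> almost_uniform (r k) (W n \<omega>)"
    show "(\<Inter>n\<in>{1..}. \<Union>i\<in>{n..}. torus_translate (U i) (v i \<omega>)) \<in> large_intersection_class s"
      unfolding limsup large_intersection_class_def
    proof (intro CollectI conjI allI impI)
      show "gdelta_in torus_topology (\<Inter>n. W n \<omega>)"
        by (intro gdelta_in_Inter) (auto intro: open_imp_gdelta_in W_open)
      fix t :: real and Q :: "(real ^ 'n) set" assume tQ: "0 < t \<and> t < s \<and> Q \<in> dyadic_cubes"
      obtain k :: nat where k: "t / (s - t) \<le> real k"
        using real_arch_simple by blast
      then have "t \<le> r k"
        using tQ by (simp add: r_def field_simps)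
      moreover have "almost_uniform (r k) (W n \<omega>)" for n
        using uniform tQ by simp
      ultimately have "almost_uniform t (W n \<omega>)" for n
        using almost_uniform_antimono by blast
      then have "ennreal (diameter Q powr t) \<le> net_content t ((\<Inter>n. W n \<omega>) \<inter> Q)"
        using tQ s_d by (intro net_content_Inter_ge W_open) auto
      then show "net_content t ((\<Inter>n. W n \<omega>) \<inter> Q) = net_content t Q"
        using net_content_cube_le[of Q t] tQ net_content_mono[of "(\<Inter>n. W n \<omega>) \<inter> Q" Q t]
        by (intro antisym) auto
    qed
  qed
qed

end
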